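(* For each $\Delta^0_2$ random Turing degree $\mathbf{r}$ and each computable ordinal $\alpha>0$, there exist a countably supported computable probability measure $\mu$ on $2^\omega$ and a sequence $R\in\mathbf{r}$ such that (i) $R$ is Martin-Löf random with respect to $\mu$, (ii) $R$ has Cantor-Bendixson rank $\alpha$, and (iii) the support of $\mu$ is rank-faithful.
   Context: A Turing degree is a $\Delta^0_2$ random degree if it is $\Delta^0_2$ (i.e. it is the degree of a set computable from the halting problem) and contains a Martin-Löf random sequence (random with respect to the Lebesgue measure). A measure $\mu$ on $2^\omega$ is computable if $\sigma\mapsto\mu(\llbracket\sigma\rrbracket)$ is computable as a real-valued function; it is countably supported if there is a countable set $\{X_i\colon i\in\omega\}$ with $\mu(\{X_i\colon i\in\omega\})=1$. For computable $\mu$, a $\mu$-Martin-Löf test is a uniformly $\Sigma^0_1$ sequence of open sets $(\mathcal U_i)$ with $\mu(\mathcal U_i)\le 2^{-i}$; $X$ is random with respect to $\mu$ if $X\notin\bigcap_i\mathcal U_i$ for every such test. The support of $\mu$ is $\{X\in 2^\omega\colon \forall n\ \mu(\llbracket X\upharpoonright n\rrbracket)>0\}$ (a $\Pi^0_1$ class when $\mu$ is computable). For a closed set $\mathcal P$, $D(\mathcal P)$ is the set of non-isolated points of $\mathcal P$, with $D^0(\mathcal P)=\mathcal P$, $D^{\beta+1}(\mathcal P)=D(D^\beta(\mathcal P))$ and $D^\kappa(\mathcal P)=\bigcap_{\beta<\kappa}D^\beta(\mathcal P)$ for limit $\kappa$. For a $\Pi^0_1$ class $\mathcal P$ and $X\in\mathcal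 P$, $\mathit{rk}_{\mathcal P}(X)$ is the least $\beta$ with $X\in D^\beta(\mathcal P)\setminus D^{\beta+1}(\mathcal P)$ (if any). $X$ is ranked if $\mathit{rk}_{\mathcal P}(X)$ is defined for some $\Pi^0_1$ class $\mathcal P$, and then its Cantor-Bendixson rank $\mathit{rk}(X)$ is the least $\beta$ such that $\mathit{rk}_{\mathcal P}(X)=\beta$ for some $\Pi^0_1$ class $\mathcal P$. A $\Pi^0_1$ class $\mathcal P$ is rank-faithful if $\mathit{rk}(X)=\mathit{rk}_{\mathcal P}(X)$ for all ranked $X\in\mathcal P$. *)

theory Defs
  imports "HOL-Probability.Probability" "HOL-Library.Nat_Bijection"
begin

section \<open>Computability\<close>

text \<open>
  Unary partial recursive functions relative to an oracle, in the pairing-function style: the basic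
  functions are zero, successor, the two projections of \<^term>\<open>prod_decode\<close> and the oracle;
  the closure operations are pairing, composition, primitive recursion and minimisation.
\<close>

datatype prog =
    ZeroP | SuccP | FstP | SndP | OracleP
  | PairP prog prog | CompP prog prog | RecP prog prog | MuP prog

type_synonym cantor = "nat \<Rightarrow> bool"

text \<open>
  \<open>run A p n\<close> is the value of \<open>p\<close> with oracle \<open>A\<close> at \<open>n\<close>, \<open>None\<close> meaning divergence.
  \<open>RecP p q\<close> at \<open>(a, 0)\<close> is \<open>p a\<close>, and at \<open>(a, k + 1)\<close> it is \<open>q (a, (k, y))\<close> with \<open>y\<close> its value at
  \<open>(a, k)\<close>. \<open>MuP p\<close> at \<open>n\<close> is the least \<open>m\<close> with \<open>p (n, m) = 0\<close>, provided that \<open>p (n, j)\<close>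
  converges for all \<open>j < m\<close>.
\<close>

primrec run :: "cantor \<Rightarrow> prog \<Rightarrow> nat \<Rightarrow> nat option" where
  "run A ZeroP n = Some 0"
| "run A SuccP n = Some (Suc n)"
| "run A FstP n = Some (fst (prod_decode n))"
| "run A SndP n = Some (snd (prod_decode n))"
| "run A OracleP n = Some (of_bool (A n))"
| "run A (PairP p q) n =
     Option.bind (run A p n) (\<lambda>x. Option.bind (run A q n) (\<lambda>y. Some (prod_encode (x, y))))"
| "run A (CompP p q) n = Option.bind (run A q n) (run A p)"
| "run A (RecP p q) n =
     rec_nat (run A p (fst (prod_decode n)))
       (\<lambda>k r. Option.bind r (\<lambda>y. run A q (prod_encode (fst (prod_decode n), prod_encode (k, y)))))
       (snd (prod_decode n))"
| "run A (MuP p) n =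
     (if \<exists>m. run A p (prod_encode (n, m)) = Some 0 \<and> (\<forall>j<m. run A p (prod_encode (n, j)) \<noteq> None)
      then Some (LEAST m. run A p (prod_encode (n, m)) = Some 0) else None)"

primrec code :: "prog \<Rightarrow> nat" where
  "code ZeroP = prod_encode (0, 0)"
| "code SuccP = prod_encode (1, 0)"
| "code FstP = prod_encode (2, 0)"
| "code SndP = prod_encode (3, 0)"
| "code OracleP = prod_encode (4, 0)"
| "code (PairP p q) = prod_encode (5, prod_encode (code p, code q))"
| "code (CompP p q) = prod_encode (6, prod_encode (code p, code q))"
| "code (RecP p q) = prod_encode (7, prod_encode (code p, code q))"
| "code (MuP p) = prod_encode (8, code p)"

lemma code_inject: "code p = code q \<longleftrightarrow> p = q"
proof (induction p arbitrary: q)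
  case ZeroP then show ?case by (cases q) simp_all
next
  case SuccP then show ?case by (cases q) simp_all
next
  case FstP then show ?case by (cases q) simp_all
next
  case SndP then show ?case by (cases q) simp_all
next
  case OracleP then show ?case by (cases q) simp_all
next
  case (PairP p1 p2) then show ?case by (cases q) simp_all
next
  case (CompP p1 p2) then show ?case by (cases q) simp_all
next
  case (RecP p1 p2) then show ?case by (cases q) simp_all
next
  case (MuP p) then show ?case by (cases q) simp_all
qed

abbreviation no_oracle :: cantor where
  "no_oracle \<equiv> (\<lambda>_. False)"

definition halting :: cantor where
  "halting e \<longleftrightarrow> (\<exists>p. code p = e \<and> run no_oracle p e \<noteq> None)"

definition computable_fun :: "(nat \<Rightarrow> nat) \<Rightarrow> bool" where
  "computable_fun f \<longleftrightarrow> (\<exists>p. \<forall>n. run no_oracle p n = Some (f n))"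

definition computable_set :: "nat set \<Rightarrow> bool" where
  "computable_set S \<longleftrightarrow> computable_fun (\<lambda>n. of_bool (n \<in> S))"

definition ce_set :: "nat set \<Rightarrow> bool" where
  "ce_set S \<longleftrightarrow> (\<exists>p. \<forall>n. n \<in> S \<longleftrightarrow> run no_oracle p n \<noteq> None)"

definition turing_reducible :: "cantor \<Rightarrow> cantor \<Rightarrow> bool" (infix \<open>\<le>\<^sub>T\<close> 50) where
  "X \<le>\<^sub>T Y \<longleftrightarrow> (\<exists>p. \<forall>n. run Y p n = Some (of_bool (X n)))"

definition turing_degree :: "cantor \<Rightarrow> cantor set" where
  "turing_degree X = {Y. X \<le>\<^sub>T Y \<and> Y \<le>\<^sub>T X}"

definition delta02_degree :: "cantor set \<Rightarrow> bool" where
  "delta02_degree r \<longleftrightarrow> (\<exists>X. X \<le>\<^sub>T halting \<and> r = turing_degree X)"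


section \<open>Effective topology and measure on Cantor space\<close>

definition cylinder :: "bool list \<Rightarrow> cantor set" where
  "cylinder \<sigma> = {X. \<forall>i<length \<sigma>. X i = \<sigma> ! i}"

definition restrict_to :: "cantor \<Rightarrow> nat \<Rightarrow> bool list" where
  "restrict_to X n = map X [0..<n]"

definition string_code :: "bool list \<Rightarrow> nat" where
  "string_code \<sigma> = list_encode (map of_bool \<sigma>)"

definition uniformly_sigma01 :: "(nat \<Rightarrow> cantor set) \<Rightarrow> bool" where
  "uniformly_sigma01 U \<longleftrightarrow>
     (\<exists>W :: (nat \<times> bool list) set.
        ce_set ((\<lambda>(i, \<sigma>). prod_encode (i, string_code \<sigma>)) ` W) \<and>
        (\<forall>i. U i = (\<Union>\<sigma>\<in>{\<sigma>. (i, \<sigma>) \<in> W}. cylinder \<sigma>)))"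

definition pi01_class :: "cantor set \<Rightarrow> bool" where
  "pi01_class P \<longleftrightarrow>
     (\<exists>W :: bool list set. ce_set (string_code ` W) \<and> P = - (\<Union>\<sigma>\<in>W. cylinder \<sigma>))"

text \<open>The real-valued function is approximated, uniformly and up to \<open>2\<^sup>-\<^sup>n\<close>, by rationals
  \<open>(a - b) / (c + 1)\<close> with \<open>a\<close>, \<open>b\<close>, \<open>c\<close> computed from the argument and \<open>n\<close>.\<close>

definition computable_real_fun :: "(bool list \<Rightarrow> real) \<Rightarrow> bool" where
  "computable_real_fun g \<longleftrightarrow>
     (\<exists>a b c. computable_fun a \<and> computable_fun b \<and> computable_fun c \<and>
        (\<forall>\<sigma> n. let x = prod_encode (string_code \<sigma>, n) in
           \<bar>g \<sigma> - (real (a x) - real (b x)) / (real (c x) + 1)\<bar> \<le> 1 / 2 ^ n))"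

definition computable_measure :: "cantor measure \<Rightarrow> bool" where
  "computable_measure \<mu> \<longleftrightarrow> computable_real_fun (\<lambda>\<sigma>. measure \<mu> (cylinder \<sigma>))"

definition countably_supported :: "cantor measure \<Rightarrow> bool" where
  "countably_supported \<mu> \<longleftrightarrow> (\<exists>X :: nat \<Rightarrow> cantor. emeasure \<mu> (range X) = 1)"

definition measure_support :: "cantor measure \<Rightarrow> cantor set" where
  "measure_support \<mu> = {X. \<forall>n. measure \<mu> (cylinder (restrict_to X n)) > 0}"

definition ml_test :: "cantor measure \<Rightarrow> (nat \<Rightarrow> cantor set) \<Rightarrow> bool" where
  "ml_test \<mu> U \<longleftrightarrow> uniformly_sigma01 U \<and> (\<forall>i. measure \<mu> (U i) \<le> 1 / 2 ^ i)"

definition ml_random :: "cantor measure \<Rightarrow> cantor \<Rightarrow> bool" where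
  "ml_random \<mu> X \<longleftrightarrow> (\<forall>U. ml_test \<mu> U \<longrightarrow> X \<notin> (\<Inter>i. U i))"

definition cantor_lebesgue :: "cantor measure" where
  "cantor_lebesgue = (\<Pi>\<^sub>M i\<in>UNIV. measure_pmf (bernoulli_pmf (1 / 2)))"

instance bool :: second_countable_topology
proof
  show "\<exists>B :: bool set set. countable B \<and> open = generate_topology B"
  proof (intro exI conjI ext)
    fix S :: "bool set"
    show "open S = generate_topology UNIV S"
      using generate_topology.Basis[of S UNIV] Topological_Spaces.open_discrete[of S] by blast
  qed (auto intro: countable_finite)
qed

lemma sets_cantor_lebesgue: "sets cantor_lebesgue = sets borel"
proof -
  have "sets cantor_lebesgue = sets (\<Pi>\<^sub>M i\<in>(UNIV :: nat set). (borel :: bool measure))"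
    unfolding cantor_lebesgue_def
    by (intro sets_PiM_cong refl) (simp add: sets_borel_eq_count_space)
  then show ?thesis by (simp add: sets_PiM_equal_borel)
qed

definition delta02_random_degree :: "cantor set \<Rightarrow> bool" where
  "delta02_random_degree r \<longleftrightarrow> delta02_degree r \<and> (\<exists>X\<in>r. ml_random cantor_lebesgue X)"


section \<open>Ordinals\<close>

text \<open>
  The order types of well-orders of subsets of \<open>2\<^sup>\<omega>\<close>, i.e. all ordinals below the successor
  cardinal of \<open>2\<^sup>\<omega>\<close>. A strictly decreasing transfinite sequence of subsets of \<open>2\<^sup>\<omega>\<close> is shorter
  than that, so no Cantor-Bendixson rank lies beyond these ordinals.
\<close>

lemma Well_order_empty: "Well_order {}"
  by simp

quotient_type ordinal = "cantor rel" / partial: "\<lambda>r s. (r, s) \<in> ordIso"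
proof (rule part_equivpI)
  show "\<exists>r :: cantor rel. (r, r) \<in> ordIso"
    using ordIso_reflexive Well_order_empty by blast
  show "symp (\<lambda>r s :: cantor rel. (r, s) \<in> ordIso)"
    by (auto intro: sympI ordIso_symmetric)
  show "transp (\<lambda>r s :: cantor rel. (r, s) \<in> ordIso)"
    by (auto intro: transpI ordIso_transitive)
qed

instantiation ordinal :: wellorder
begin

lift_definition less_eq_ordinal :: "ordinal \<Rightarrow> ordinal \<Rightarrow> bool" is "\<lambda>r s. (r, s) \<in> ordLeq"
  by (meson ordIso_ordLeq_trans ordLeq_ordIso_trans ordIso_symmetric)

lift_definition less_ordinal :: "ordinal \<Rightarrow> ordinal \<Rightarrow> bool" is "\<lambda>r s. (r, s) \<in> ordLess"
  by (meson ordIso_ordLess_trans ordLess_ordIso_trans ordIso_symmetric)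

instance
proof
  fix x y z :: ordinal
  show "x < y \<longleftrightarrow> x \<le> y \<and> \<not> y \<le> x"
    by transfer
      (use not_ordLess_ordLeq ordLess_imp_ordLeq ordLeq_iff_ordLess_or_ordIso ordIso_iff_ordLeq in blast)
  show "x \<le> x"
    by transfer (simp add: ordIso_iff_ordLeq)
  show "x \<le> z" if "x \<le> y" "y \<le> z"
    using that by transfer (rule ordLeq_transitive)
  show "x = y" if "x \<le> y" "y \<le> x"
    using that by transfer (simp add: ordIso_iff_ordLeq)
  show "x \<le> y \<or> y \<le> x"
    by transfer (auto simp: ordIso_def dest: ordLeq_total)
next
  fix P :: "ordinal \<Rightarrow> bool" and a :: ordinal
  assume step: "\<And>x. (\<And>y. y < x \<Longrightarrow> P y) \<Longrightarrow> P x"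
  have "P (abs_ordinal r)" if "Well_order r" for r :: "cantor rel"
    using wf_ordLess that
  proof (induction r rule: wf_induct_rule)
    case (less r)
    have r: "(r, r) \<in> ordIso"
      using less.prems by (rule ordIso_reflexive)
    show ?case
    proof (rule step)
      fix y assume y: "y < abs_ordinal r"
      obtain s where s: "(s, s) \<in> ordIso" "y = abs_ordinal s"
        by (rule that[of "rep_ordinal y"])
          (simp_all add: Quotient_rep_reflp[OF Quotient_ordinal] Quotient_abs_rep[OF Quotient_ordinal])
      then have "(s, r) \<in> ordLess"
        using y r by (simp add: less_ordinal.abs_eq eq_onp_def)
      then show "P y"
        using less.IH s(2) unfolding ordLess_def by blast
    qed
  qed
  then show "P a"
    using Quotient_rep_reflp[OF Quotient_ordinal, of a] Quotient_abs_rep[OF Quotient_ordinal, of a]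
    by (metis ordIso_iff_ordLeq ordLeq_Well_order_simp)
qed

end

instantiation ordinal :: zero
begin

lift_definition zero_ordinal :: ordinal is "{}"
  using ordIso_reflexive Well_order_empty by blast

instance ..

end

lift_definition has_order_type :: "nat rel \<Rightarrow> ordinal \<Rightarrow> bool" is "\<lambda>r s. (r, s) \<in> ordIso"
  by (meson ordIso_transitive ordIso_symmetric)

definition computable_ordinal :: "ordinal \<Rightarrow> bool" where
  "computable_ordinal \<alpha> \<longleftrightarrow>
     (\<exists>r :: nat rel. Well_order r \<and> computable_set (prod_encode ` r) \<and> has_order_type r \<alpha>)"


section \<open>Cantor-Bendixson rank\<close>

definition cb_derivative :: "cantor set \<Rightarrow> cantor set" where
  "cb_derivative P = {X \<in> P. \<not> X isolated_in P}"

definition is_successor :: "ordinal \<Rightarrow> ordinal \<Rightarrow> bool" where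
  "is_successor \<beta> \<gamma> \<longleftrightarrow> \<gamma> < \<beta> \<and> (\<forall>\<delta><\<beta>. \<delta> \<le> \<gamma>)"

lemma the_is_successor: "is_successor \<beta> \<gamma> \<Longrightarrow> (THE \<gamma>. is_successor \<beta> \<gamma>) = \<gamma>"
  by (rule the_equality) (auto simp: is_successor_def intro: antisym)

function iterated_derivative :: "cantor set \<Rightarrow> ordinal \<Rightarrow> cantor set" where
  "iterated_derivative P \<beta> =
     (if \<beta> = 0 then P
      else if \<exists>\<gamma>. is_successor \<beta> \<gamma>
      then cb_derivative (iterated_derivative P (THE \<gamma>. is_successor \<beta> \<gamma>))
      else (\<Inter>\<gamma>\<in>{..<\<beta>}. iterated_derivative P \<gamma>))"
  by auto
termination
proof (relation "inv_image {(x, y). x < y} snd")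
  show "wf (inv_image {(x :: ordinal, y). x < y} (snd :: cantor set \<times> ordinal \<Rightarrow> ordinal))"
    by (intro wf_inv_image wf)
qed (auto simp: the_is_successor, auto simp: is_successor_def)

declare iterated_derivative.simps [simp del]

lemma not_less_zero_ordinal: "\<not> \<gamma> < (0 :: ordinal)"
proof -
  have "0 \<le> \<gamma>" for \<gamma> :: ordinal
    by transfer (auto simp: ordIso_def ordLeq_def embed_def)
  then show ?thesis by (simp add: not_less)
qed

lemma iterated_derivative_zero: "iterated_derivative P 0 = P"
  by (simp add: iterated_derivative.simps)

lemma iterated_derivative_successor:
  "is_successor \<beta> \<gamma> \<Longrightarrow> iterated_derivative P \<beta> = cb_derivative (iterated_derivative P \<gamma>)"
  by (subst iterated_derivative.simps)
    (auto simp: the_is_successor is_successor_def not_less_zero_ordinal)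

lemma iterated_derivative_limit:
  "\<beta> \<noteq> 0 \<Longrightarrow> \<nexists>\<gamma>. is_successor \<beta> \<gamma> \<Longrightarrow>
     iterated_derivative P \<beta> = (\<Inter>\<gamma>\<in>{..<\<beta>}. iterated_derivative P \<gamma>)"
  using iterated_derivative.simps[of P \<beta>] by auto

definition exits_at :: "cantor set \<Rightarrow> cantor \<Rightarrow> ordinal \<Rightarrow> bool" where
  "exits_at P X \<beta> \<longleftrightarrow> X \<in> iterated_derivative P \<beta> - cb_derivative (iterated_derivative P \<beta>)"

definition rank_in_defined :: "cantor set \<Rightarrow> cantor \<Rightarrow> bool" where
  "rank_in_defined P X \<longleftrightarrow> (\<exists>\<beta>. exits_at P X \<beta>)"

text \<open>Meaningful only if \<^const>\<open>rank_in_defined\<close> holds; likewise \<open>cb_rank\<close> below presupposes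
  \<open>ranked\<close>.\<close>

definition rank_in :: "cantor set \<Rightarrow> cantor \<Rightarrow> ordinal" where
  "rank_in P X = (LEAST \<beta>. exits_at P X \<beta>)"

definition ranked :: "cantor \<Rightarrow> bool" where
  "ranked X \<longleftrightarrow> (\<exists>P. pi01_class P \<and> X \<in> P \<and> rank_in_defined P X)"

definition cb_rank :: "cantor \<Rightarrow> ordinal" where
  "cb_rank X =
     (LEAST \<beta>. \<exists>P. pi01_class P \<and> X \<in> P \<and> rank_in_defined P X \<and> rank_in P X = \<beta>)"

definition rank_faithful :: "cantor set \<Rightarrow> bool" where
  "rank_faithful P \<longleftrightarrow> pi01_class P \<and>
     (\<forall>X\<in>P. ranked X \<longrightarrow> rank_in_defined P X \<and> cb_rank X = rank_in P X)"

end

theory Submission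
  imports Defs
begin

text \<open>
  Let \<open>X\<close> be a random sequence in the degree and \<open>Xs t\<close> a computable approximation of it. Well-order a
  computable set of columns of \<open>\<nat>\<close> in type \<open>\<alpha>\<close>. A computable functional \<open>Phi\<close> compares its input \<open>Z\<close>,
  column by column, with the approximations and outputs 1 whenever one more bit of a column is
  confirmed; a column may advance only if the columns below it in the well-order are further
  advanced. So if \<open>b\<close> is the least column on which \<open>Z\<close> differs from \<open>X\<close>, then exactly the columns
  below \<open>b\<close> advance for ever, and \<open>Phi Z\<close> depends on only finitely many bits of \<open>Z\<close> besides those of \<open>X\<close>.
  Hence the image of Lebesgue measure under \<open>Phi\<close> is countably supported, and in its support the rank
  of \<open>Phi Z\<close> is at most the order type of the columns below \<open>b\<close>, and that of \<open>Phi X\<close> at most \<open>\<alpha>\<close>.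
  Moreover \<open>Phi X\<close> is Turing equivalent to \<open>X\<close>, and random by conservation of randomness.

  These ranks are attained in every \<open>\<Pi>\<^sup>0\<^sub>1\<close> class \<open>Q\<close> containing the point: let \<open>Z\<close> agree with \<open>X\<close> on the
  columns up to \<open>c\<close>. If no other sequence with the same prefix and the same bits off \<open>c\<close> were mapped into \<open>Q\<close>, this
  column of \<open>X\<close> would be determined by the others, against randomness. So points whose first error
  is in column \<open>c\<close> accumulate at \<open>Phi Z\<close> within \<open>Q\<close>.
\<close>

section \<open>Closure properties of the recursive functions\<close>

abbreviation pfst :: "nat \<Rightarrow> nat" where "pfst n \<equiv> fst (prod_decode n)"
abbreviation psnd :: "nat \<Rightarrow> nat" where "psnd n \<equiv> snd (prod_decode n)"
abbreviation pair :: "nat \<Rightarrow> nat \<Rightarrow> nat" where "pair a b \<equiv> prod_encode (a, b)"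

definition rec_in :: "cantor \<Rightarrow> (nat \<Rightarrow> nat) \<Rightarrow> bool" where
  "rec_in A f \<longleftrightarrow> (\<exists>p. \<forall>n. run A p n = Some (f n))"

definition dec_in :: "cantor \<Rightarrow> (nat \<Rightarrow> bool) \<Rightarrow> bool" where
  "dec_in A P \<longleftrightarrow> rec_in A (\<lambda>x. of_bool (P x))"

definition rec2_in :: "cantor \<Rightarrow> (nat \<Rightarrow> nat \<Rightarrow> nat) \<Rightarrow> bool" where
  "rec2_in A f \<longleftrightarrow> rec_in A (\<lambda>z. f (pfst z) (psnd z))"

definition dec2_in :: "cantor \<Rightarrow> (nat \<Rightarrow> nat \<Rightarrow> bool) \<Rightarrow> bool" where
  "dec2_in A P \<longleftrightarrow> dec_in A (\<lambda>z. P (pfst z) (psnd z))"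

lemma rec_in_id: "rec_in A (\<lambda>x. x)"
  unfolding rec_in_def by (rule exI[of _ "PairP FstP SndP"]) simp

lemma rec_in_const: "rec_in A (\<lambda>x. c)"
proof (induction c)
  case 0
  show ?case unfolding rec_in_def by (rule exI[of _ ZeroP]) simp
next
  case (Suc c)
  then obtain p where "\<forall>n. run A p n = Some c" unfolding rec_in_def by blast
  then show ?case unfolding rec_in_def by (intro exI[of _ "CompP SuccP p"]) simp
qed

lemma rec_in_comp:
  assumes "rec_in A f" "rec_in A g"
  shows "rec_in A (\<lambda>x. f (g x))"
proof -
  from assms obtain p q where "\<forall>n. run A p n = Some (f n)" "\<forall>n. run A q n = Some (g n)"
    unfolding rec_in_def by blast
  then show ?thesis unfolding rec_in_def by (intro exI[of _ "CompP p q"]) simp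
qed

lemma rec_in_pair:
  assumes "rec_in A f" "rec_in A g"
  shows "rec_in A (\<lambda>x. pair (f x) (g x))"
proof -
  from assms obtain p q where "\<forall>n. run A p n = Some (f n)" "\<forall>n. run A q n = Some (g n)"
    unfolding rec_in_def by blast
  then show ?thesis unfolding rec_in_def by (intro exI[of _ "PairP p q"]) simp
qed

lemma rec_in_pfst: "rec_in A f \<Longrightarrow> rec_in A (\<lambda>x. pfst (f x))"
  by (rule rec_in_comp[of _ pfst]) (auto simp: rec_in_def intro: exI[of _ FstP])

lemma rec_in_psnd: "rec_in A f \<Longrightarrow> rec_in A (\<lambda>x. psnd (f x))"
  by (rule rec_in_comp[of _ psnd]) (auto simp: rec_in_def intro: exI[of _ SndP])

lemma rec_in_Suc: "rec_in A f \<Longrightarrow> rec_in A (\<lambda>x. Suc (f x))"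
  by (rule rec_in_comp[of _ Suc]) (auto simp: rec_in_def intro: exI[of _ SuccP])

lemma dec_in_oracle: "rec_in A f \<Longrightarrow> dec_in A (\<lambda>x. A (f x))"
  unfolding dec_in_def
  by (rule rec_in_comp[of _ "\<lambda>x. of_bool (A x)"]) (auto simp: rec_in_def intro: exI[of _ OracleP])

lemma rec_in_comp2: "rec2_in A f \<Longrightarrow> rec_in A g \<Longrightarrow> rec_in A h \<Longrightarrow> rec_in A (\<lambda>x. f (g x) (h x))"
  using rec_in_comp[of A "\<lambda>z. f (pfst z) (psnd z)", OF _ rec_in_pair]
  by (simp add: rec2_in_def)

lemma dec_in_comp: "dec_in A P \<Longrightarrow> rec_in A f \<Longrightarrow> dec_in A (\<lambda>x. P (f x))"
  unfolding dec_in_def by (rule rec_in_comp)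

lemma dec_in_comp2: "dec2_in A P \<Longrightarrow> rec_in A g \<Longrightarrow> rec_in A h \<Longrightarrow> dec_in A (\<lambda>x. P (g x) (h x))"
  using rec_in_comp2[of A "\<lambda>x y. of_bool (P x y)" g h]
  by (simp add: rec2_in_def dec2_in_def dec_in_def)

text \<open>\<open>RecP\<close> passes its first argument to every round, so feeding it
  \<open>x\<close> itself lets the step function depend on \<open>x\<close>; the number of rounds is
  composed in afterwards.\<close>

lemma rec_in_rec:
  assumes f: "rec_in A f" and h: "rec_in A h"
    and g: "rec_in A (\<lambda>z. g (pfst z) (pfst (psnd z)) (psnd (psnd z)))"
  shows "rec_in A (\<lambda>x. rec_nat (f x) (g x) (h x))"
proof -
  obtain p where p: "\<forall>n. run A p n = Some (f n)" using f unfolding rec_in_def by blast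
  obtain q where q: "\<forall>z. run A q z = Some (g (pfst z) (pfst (psnd z)) (psnd (psnd z)))"
    using g unfolding rec_in_def by blast
  have "run A (RecP p q) (pair x k) = Some (rec_nat (f x) (g x) k)" for x k
    by (induction k) (simp_all add: p q)
  then have "rec_in A (\<lambda>z. rec_nat (f (pfst z)) (g (pfst z)) (psnd z))"
    unfolding rec_in_def by (metis prod.collapse prod_decode_inverse)
  then have "rec2_in A (\<lambda>x k. rec_nat (f x) (g x) k)" by (simp add: rec2_in_def)
  from rec_in_comp2[OF this rec_in_id h] show ?thesis .
qed

lemmas rec_basic = rec_in_pfst rec_in_psnd rec_in_Suc rec_in_pair rec_in_id rec_in_const

section \<open>Arithmetic, decidable predicates and bounded search\<close>

lemma rec_in_add:
  assumes "rec_in A f" "rec_in A g" shows "rec_in A (\<lambda>x. f x + g x)"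
proof -
  have "a + b = rec_nat a (\<lambda>k y. Suc y) b" for a b :: nat by (induction b) simp_all
  then show ?thesis by (simp only:) (intro rec_in_rec assms rec_basic)
qed

lemma rec_in_pred:
  assumes "rec_in A f" shows "rec_in A (\<lambda>x. f x - 1)"
proof -
  have "a - 1 = rec_nat 0 (\<lambda>k y. k) a" for a :: nat by (cases a) simp_all
  then show ?thesis by (simp only:) (intro rec_in_rec assms rec_basic)
qed

lemma rec_in_sub:
  assumes "rec_in A f" "rec_in A g" shows "rec_in A (\<lambda>x. f x - g x)"
proof -
  have "a - b = rec_nat a (\<lambda>k y. y - 1) b" for a b :: nat by (induction b) simp_all
  then have eq: "(\<lambda>x. f x - g x) = (\<lambda>x. rec_nat (f x) (\<lambda>k y. y - 1) (g x))" by blast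
  show ?thesis unfolding eq by (intro rec_in_rec rec_in_pred assms rec_basic)
qed

lemma rec_in_mult:
  assumes "rec_in A f" "rec_in A g" shows "rec_in A (\<lambda>x. f x * g x)"
proof -
  have "a * b = rec_nat 0 (\<lambda>k y. y + a) b" for a b :: nat by (induction b) simp_all
  then show ?thesis
    by (simp only:) (intro rec_in_rec rec_in_add rec_in_comp[OF assms(1)] assms rec_basic)
qed

lemma rec_in_power:
  assumes "rec_in A f" "rec_in A g" shows "rec_in A (\<lambda>x. f x ^ g x)"
proof -
  have "a ^ b = rec_nat 1 (\<lambda>k y. y * a) b" for a b :: nat by (induction b) simp_all
  then show ?thesis
    by (simp only:) (intro rec_in_rec rec_in_mult rec_in_comp[OF assms(1)] assms rec_basic)
qed

lemma dec_in_const: "dec_in A (\<lambda>x. c)"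
  unfolding dec_in_def by (rule rec_in_const)

lemma dec_in_not: assumes "dec_in A P" shows "dec_in A (\<lambda>x. \<not> P x)"
proof -
  have eq: "(\<lambda>x. of_bool (\<not> P x)) = (\<lambda>x. 1 - of_bool (P x) :: nat)" by auto
  show ?thesis using assms unfolding dec_in_def eq by (intro rec_in_sub rec_in_const)
qed

lemma dec_in_conj:
  assumes "dec_in A P" "dec_in A Q" shows "dec_in A (\<lambda>x. P x \<and> Q x)"
  using assms rec_in_mult[of A "\<lambda>x. of_bool (P x)" "\<lambda>x. of_bool (Q x)"] unfolding dec_in_def
  by (simp add: of_bool_conj)

lemma dec_in_disj:
  assumes "dec_in A P" "dec_in A Q" shows "dec_in A (\<lambda>x. P x \<or> Q x)"
  using dec_in_not[OF dec_in_conj[OF dec_in_not dec_in_not, OF assms]] by simp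

lemma dec_in_imp:
  assumes "dec_in A P" "dec_in A Q" shows "dec_in A (\<lambda>x. P x \<longrightarrow> Q x)"
  unfolding imp_conv_disj by (intro dec_in_disj dec_in_not assms)

lemma dec_in_less:
  assumes "rec_in A f" "rec_in A g" shows "dec_in A (\<lambda>x. f x < g x)"
proof -
  have eq: "(\<lambda>x. of_bool (f x < g x)) = (\<lambda>x. 1 - (1 - (g x - f x)))"
    by (rule ext) (simp add: of_bool_def)
  show ?thesis unfolding dec_in_def eq by (intro rec_in_sub rec_in_const assms)
qed

lemma dec_in_le:
  assumes "rec_in A f" "rec_in A g" shows "dec_in A (\<lambda>x. f x \<le> g x)"
  unfolding not_less[symmetric] by (intro dec_in_not dec_in_less assms)

lemma dec_in_eq:
  assumes "rec_in A f" "rec_in A g" shows "dec_in A (\<lambda>x. f x = g x)"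
  unfolding order_eq_iff[of "f _"] by (intro dec_in_conj dec_in_le assms)

lemma dec_in_iff:
  assumes "dec_in A P" "dec_in A Q" shows "dec_in A (\<lambda>x. P x = Q x)"
  unfolding iff_conv_conj_imp by (intro dec_in_conj dec_in_imp assms)

lemma rec_in_if:
  assumes "dec_in A P" "rec_in A f" "rec_in A g"
  shows "rec_in A (\<lambda>x. if P x then f x else g x)"
proof -
  have eq: "(\<lambda>x. if P x then f x else g x) = (\<lambda>x. of_bool (P x) * f x + (1 - of_bool (P x)) * g x)"
    by (rule ext) simp
  show ?thesis using assms unfolding dec_in_def eq
    by (intro rec_in_add rec_in_mult rec_in_sub rec_in_const)
qed

lemma dec_in_if:
  assumes "dec_in A P" "dec_in A Q" "dec_in A R"
  shows "dec_in A (\<lambda>x. if P x then Q x else R x)"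
proof -
  have eq: "(\<lambda>x. if P x then Q x else R x) = (\<lambda>x. (P x \<longrightarrow> Q x) \<and> (\<not> P x \<longrightarrow> R x))"
    by (rule ext) simp
  show ?thesis using assms unfolding eq by (intro dec_in_conj dec_in_imp dec_in_not)
qed

lemma rec_in_of_bool: "dec_in A P \<Longrightarrow> rec_in A (\<lambda>x. of_bool (P x))"
  by (simp add: dec_in_def)

lemma rec2_inI: "rec_in A (\<lambda>z. f (pfst z) (psnd z)) \<Longrightarrow> rec2_in A f"
  by (simp add: rec2_in_def)

lemma dec2_inI: "dec_in A (\<lambda>z. P (pfst z) (psnd z)) \<Longrightarrow> dec2_in A P"
  by (simp add: dec2_in_def)

lemma rec_in_sum:
  assumes f: "rec2_in A f" and h: "rec_in A h"
  shows "rec_in A (\<lambda>x. \<Sum>n<h x. f x n)"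
proof -
  have "(\<Sum>n<b. f x n) = rec_nat 0 (\<lambda>k y. y + f x k) b" for b x by (induction b) simp_all
  then show ?thesis
    by (simp only:) (intro rec_in_rec rec_in_add rec_in_comp2[OF f] h rec_basic)
qed

lemma dec_in_ball_less:
  assumes P: "dec2_in A P" and h: "rec_in A h"
  shows "dec_in A (\<lambda>x. \<forall>n<h x. P x n)"
proof -
  have "(\<forall>n<b. P x n) \<longleftrightarrow> (\<Sum>n<b. of_bool (\<not> P x n) :: nat) = 0" for x b
    by (simp add: sum_eq_0_iff) blast
  moreover have "rec2_in A (\<lambda>x n. of_bool (\<not> P x n))"
    using P unfolding dec2_in_def rec2_in_def by (intro rec_in_of_bool dec_in_not)
  ultimately show ?thesis
    by (simp only:) (intro dec_in_eq rec_in_sum h rec_in_const)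
qed

lemma dec_in_bex_less:
  assumes P: "dec2_in A P" and h: "rec_in A h"
  shows "dec_in A (\<lambda>x. \<exists>n<h x. P x n)"
proof -
  have "dec2_in A (\<lambda>x n. \<not> P x n)" using P unfolding dec2_in_def by (rule dec_in_not)
  from dec_in_not[OF dec_in_ball_less[OF this h]] show ?thesis by simp
qed

lemma dec_in_ball_le:
  assumes P: "dec2_in A P" and h: "rec_in A h"
  shows "dec_in A (\<lambda>x. \<forall>n\<le>h x. P x n)"
  using dec_in_ball_less[OF P rec_in_Suc[OF h]] by (simp add: less_Suc_eq_le)

lemma dec_in_bex_le:
  assumes P: "dec2_in A P" and h: "rec_in A h"
  shows "dec_in A (\<lambda>x. \<exists>n\<le>h x. P x n)"
  using dec_in_bex_less[OF P rec_in_Suc[OF h]] by (simp add: less_Suc_eq_le)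

lemma rec_in_div:
  assumes "rec_in A f" "rec_in A g"
  shows "rec_in A (\<lambda>x. f x div g x)"
proof -
  \<comment> \<open>The quotient counts the positive multiples of \<open>b\<close> up to
    \<open>a\<close>; the guard \<open>0 < b\<close> reproduces the convention that division by 0
    gives 0.\<close>
  have "a div b = (\<Sum>k<a. of_bool (0 < b \<and> Suc k * b \<le> a))" for a b :: nat
  proof (cases "b = 0")
    case False
    then have iff: "Suc k * b \<le> a \<longleftrightarrow> k < a div b" for k
      by (metis Suc_le_eq gr0I less_eq_div_iff_mult_less_eq)
    have "{..<a} \<inter> {k. k < a div b} = {..<a div b}"
      using div_le_dividend[of a b] by (auto intro: less_le_trans)
    with False show ?thesis by (simp add: iff sum_of_bool_eq del: mult_Suc)
  qed simp
  then have eq: "(\<lambda>x. f x div g x) = (\<lambda>x. \<Sum>k<f x. of_bool (0 < g x \<and> Suc k * g x \<le> f x))"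
    by (intro ext)
  show ?thesis unfolding eq
    by (intro rec_in_sum assms rec_in_of_bool dec_in_conj dec_in_less dec_in_le rec_in_mult
        rec_in_comp[OF assms(1)] rec_in_comp[OF assms(2)] rec2_inI rec_basic)
qed

lemma dec_in_odd: assumes "rec_in A f" shows "dec_in A (\<lambda>x. odd (f x))"
proof -
  have "odd a \<longleftrightarrow> a \<noteq> 2 * (a div 2)" for a :: nat
    by (metis dvd_triv_left dvd_mult_div_cancel)
  then have eq: "(\<lambda>x. odd (f x)) = (\<lambda>x. f x \<noteq> 2 * (f x div 2))" by blast
  show ?thesis
    unfolding eq by (intro dec_in_not dec_in_eq rec_in_mult rec_in_div assms rec_in_const)
qed

lemma dec_in_bit:
  assumes "rec_in A f" "rec_in A g" shows "dec_in A (\<lambda>x. bit (f x) (g x))"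
  unfolding bit_iff_odd by (intro dec_in_odd rec_in_div rec_in_power assms rec_in_const)

text \<open>\<open>MuP\<close> looks for a zero, so the program searched computes the negation of
  \<open>P\<close>; as it is total, the convergence condition in \<open>run\<close> holds
  trivially.\<close>

lemma rec_in_LEAST:
  assumes P: "dec2_in A P" and ex: "\<And>x. \<exists>m. P x m"
  shows "rec_in A (\<lambda>x. LEAST m. P x m)"
proof -
  have "rec_in A (\<lambda>z. of_bool (\<not> P (pfst z) (psnd z)))"
    using P unfolding dec2_in_def by (intro rec_in_of_bool dec_in_not)
  then obtain p where p: "\<forall>z. run A p z = Some (of_bool (\<not> P (pfst z) (psnd z)))"
    unfolding rec_in_def by blast
  have "run A (MuP p) x = Some (LEAST m. P x m)" for x
    using ex[of x] by (auto simp: p)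
  then show ?thesis unfolding rec_in_def by blast
qed

lemmas rec_intros = rec_in_of_bool rec_in_pfst rec_in_psnd rec_in_Suc rec_in_pair
  rec_in_add rec_in_pred rec_in_sub rec_in_mult rec_in_power rec_in_div rec_in_if
  rec_in_sum rec2_inI dec2_inI
  dec_in_not dec_in_conj dec_in_disj dec_in_imp dec_in_less dec_in_le dec_in_eq
  dec_in_iff dec_in_if dec_in_ball_less dec_in_bex_less dec_in_ball_le dec_in_bex_le
  dec_in_odd dec_in_bit rec_in_id rec_in_const dec_in_const

lemma computable_fun_iff: "computable_fun f \<longleftrightarrow> rec_in no_oracle f"
  by (simp add: computable_fun_def rec_in_def)

lemma computable_set_iff: "computable_set S \<longleftrightarrow> dec_in no_oracle (\<lambda>n. n \<in> S)"
  by (simp add: computable_set_def computable_fun_iff dec_in_def)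

lemma turing_reducible_iff: "X \<le>\<^sub>T Y \<longleftrightarrow> dec_in Y X"
  by (simp add: turing_reducible_def dec_in_def rec_in_def)

section \<open>Substituting a program for the oracle\<close>

primrec replace_oracle :: "prog \<Rightarrow> prog \<Rightarrow> prog" where
  "replace_oracle r ZeroP = ZeroP"
| "replace_oracle r SuccP = SuccP"
| "replace_oracle r FstP = FstP"
| "replace_oracle r SndP = SndP"
| "replace_oracle r OracleP = r"
| "replace_oracle r (PairP p q) = PairP (replace_oracle r p) (replace_oracle r q)"
| "replace_oracle r (CompP p q) = CompP (replace_oracle r p) (replace_oracle r q)"
| "replace_oracle r (RecP p q) = RecP (replace_oracle r p) (replace_oracle r q)"
| "replace_oracle r (MuP p) = MuP (replace_oracle r p)"

lemma run_replace_oracle: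
  assumes "\<And>n. run A r n = Some (of_bool (B n))"
  shows "run A (replace_oracle r p) = run B p"
  by (induction p; intro ext; simp add: assms)

lemma rec_in_trans:
  assumes "rec_in B f" "dec_in A B"
  shows "rec_in A f"
proof -
  from assms obtain p r where p: "\<forall>n. run B p n = Some (f n)"
    and r: "\<forall>n. run A r n = Some (of_bool (B n))"
    unfolding dec_in_def rec_in_def by blast
  from r have "run A (replace_oracle r p) = run B p" by (intro run_replace_oracle) simp
  with p show ?thesis unfolding rec_in_def by (intro exI[of _ "replace_oracle r p"]) simp
qed

lemma dec_in_trans: "dec_in B P \<Longrightarrow> dec_in A B \<Longrightarrow> dec_in A P"
  unfolding dec_in_def[of _ P] by (rule rec_in_trans)

lemma rec_in_no_oracle: "rec_in no_oracle f \<Longrightarrow> rec_in A f"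
  by (rule rec_in_trans[OF _ dec_in_const])

lemma dec_in_no_oracle: "dec_in no_oracle P \<Longrightarrow> dec_in A P"
  by (rule dec_in_trans[OF _ dec_in_const])

lemma dec2_in_no_oracle: "dec2_in no_oracle P \<Longrightarrow> dec2_in A P"
  unfolding dec2_in_def by (rule dec_in_no_oracle)

lemma turing_reducible_trans: "X \<le>\<^sub>T Y \<Longrightarrow> Y \<le>\<^sub>T Z \<Longrightarrow> X \<le>\<^sub>T Z"
  unfolding turing_reducible_iff by (rule dec_in_trans)

section \<open>Finite histories as numbers\<close>

text \<open>A prefix of length \<open>s\<close> is a number below \<open>2 ^ s\<close>, least
  significant bit first; \<open>bit\<close> recovers the prefix and is False beyond it.\<close>

definition num :: "cantor \<Rightarrow> nat \<Rightarrow> nat" where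
  "num Z s = horner_sum of_bool 2 (map Z [0..<s])"

lemma num_0 [simp]: "num Z 0 = 0"
  by (simp add: num_def)

lemma num_Suc: "num Z (Suc s) = num Z s + of_bool (Z s) * 2 ^ s"
  by (simp add: num_def horner_sum_append)

lemma bit_num: "bit (num Z s) n \<longleftrightarrow> n < s \<and> Z n"
  by (auto simp: num_def bit_horner_sum_bit_iff)

lemma num_bit: "num (bit z) s = take_bit s z"
  by (simp add: num_def horner_sum_bit_eq_take_bit)

lemma num_less: "num Z s < 2 ^ s"
  by (induction s) (auto simp: num_Suc)

lemma num_bit_less: "z < 2 ^ s \<Longrightarrow> num (bit z) s = z"
  by (simp add: num_bit take_bit_nat_eq_self)

lemma num_eq_iff: "num Z s = num Z' s \<longleftrightarrow> (\<forall>n<s. Z n = Z' n)"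
proof
  assume "num Z s = num Z' s"
  then show "\<forall>n<s. Z n = Z' n" by (metis bit_num)
next
  assume "\<forall>n<s. Z n = Z' n"
  then show "num Z s = num Z' s" unfolding num_def by (intro arg_cong[where f = "horner_sum _ _"]) simp
qed

text \<open>Course-of-values recursion with the values so far packed into a number, so that ordinary
  primitive recursion computes it.\<close>

primrec hist :: "(cantor \<Rightarrow> nat \<Rightarrow> bool) \<Rightarrow> nat \<Rightarrow> nat" where
  "hist F 0 = 0"
| "hist F (Suc t) = hist F t + of_bool (F (bit (hist F t)) t) * 2 ^ t"

definition course_rec :: "(cantor \<Rightarrow> nat \<Rightarrow> bool) \<Rightarrow> cantor" where
  "course_rec F t = F (bit (hist F t)) t"

lemma hist_eq_num: "hist F t = num (course_rec F) t"
  by (induction t) (simp_all add: num_Suc course_rec_def)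

text \<open>\<open>hist\<close> hands \<open>F\<close> a sequence that is sure to agree with
  \<open>course_rec F\<close> only below \<open>t\<close>; the hypothesis says that \<open>F\<close>
  looks no further.\<close>

lemma course_rec_unfold:
  assumes "\<And>Y Y' t. (\<And>s. s < t \<Longrightarrow> Y s = Y' s) \<Longrightarrow> F Y t = F Y' t"
  shows "course_rec F t = F (course_rec F) t"
  unfolding course_rec_def[of F t] hist_eq_num by (rule assms) (simp add: bit_num)

lemma rec_in_num:
  assumes Z: "dec2_in A Z" and s: "rec_in A s"
  shows "rec_in A (\<lambda>x. num (Z x) (s x))"
proof -
  have "num (Z x) k = rec_nat 0 (\<lambda>k y. y + of_bool (Z x k) * 2 ^ k) k" for x k
    by (induction k) (simp_all add: num_Suc)
  then have eq: "(\<lambda>x. num (Z x) (s x)) = (\<lambda>x. rec_nat 0 (\<lambda>k y. y + of_bool (Z x k) * 2 ^ k) (s x))"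
    by (intro ext)
  show ?thesis unfolding eq by (intro rec_in_rec dec_in_comp2[OF Z] s rec_intros)
qed

lemma rec_in_hist:
  assumes F: "dec_in A (\<lambda>z. F (pfst z) (bit (psnd (psnd z))) (pfst (psnd z)))" and s: "rec_in A s"
  shows "rec_in A (\<lambda>x. hist (F x) (s x))"
proof -
  have "hist (F x) k = rec_nat 0 (\<lambda>k y. y + of_bool (F x (bit y) k) * 2 ^ k) k" for x k
    by (induction k) simp_all
  then have eq: "(\<lambda>x. hist (F x) (s x)) = (\<lambda>x. rec_nat 0 (\<lambda>k y. y + of_bool (F x (bit y) k) * 2 ^ k) (s x))"
    by (intro ext)
  show ?thesis unfolding eq by (intro rec_in_rec F s rec_intros)
qed

section \<open>An abstract machine\<close>

definition code_cond :: "cantor \<Rightarrow> nat \<Rightarrow> bool" where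
  "code_cond Y e \<longleftrightarrow>
     pfst e < 5 \<and> psnd e = 0 \<or>
     5 \<le> pfst e \<and> pfst e \<le> 7 \<and> Y (pfst (psnd e)) \<and> Y (psnd (psnd e)) \<or>
     pfst e = 8 \<and> Y (psnd e)"

definition is_code :: cantor where
  "is_code = course_rec code_cond"

lemma triangle_ge: "k \<le> triangle k"
  by (induction k) simp_all

text \<open>A course-of-values recursion may consult smaller numbers only. A positive tag makes the
  component strictly smaller, since the pairing is a triangular number plus the first
  component.\<close>

lemma psnd_less: "0 < pfst e \<Longrightarrow> psnd e < e"
proof -
  assume "0 < pfst e"
  moreover have "m + n + m \<le> pair m n" for m n
    using triangle_ge[of "m + n"] by (simp add: prod_encode_def)
  from this[of "pfst e" "psnd e"] have "pfst e + psnd e + pfst e \<le> e" by simp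
  ultimately show ?thesis by simp
qed

lemma pfst_le: "pfst e \<le> e" and psnd_le: "psnd e \<le> e"
  using le_prod_encode_1[of "pfst e" "psnd e"] le_prod_encode_2[of "psnd e" "pfst e"] by simp_all

lemma is_code_unfold: "is_code e = code_cond is_code e"
  unfolding is_code_def
proof (rule course_rec_unfold)
  fix Y Y' :: cantor and e assume eq: "\<And>s. s < e \<Longrightarrow> Y s = Y' s"
  show "code_cond Y e = code_cond Y' e"
  proof (cases "0 < pfst e")
    case True
    then have "psnd e < e" by (rule psnd_less)
    then have "Y (pfst (psnd e)) = Y' (pfst (psnd e))" "Y (psnd (psnd e)) = Y' (psnd (psnd e))"
      "Y (psnd e) = Y' (psnd e)"
      by (auto intro!: eq intro: le_less_trans[OF pfst_le] le_less_trans[OF psnd_le])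
    then show ?thesis by (simp add: code_cond_def)
  qed (simp add: code_cond_def)
qed

lemma is_code_iff: "is_code e \<longleftrightarrow> (\<exists>p. code p = e)"
proof
  assume "\<exists>p. code p = e"
  then obtain p where "code p = e" by blast
  moreover have "is_code (code p)"
    by (induction p) (simp_all add: is_code_unfold[of "pair _ _"] code_cond_def)
  ultimately show "is_code e" by simp
next
  show "is_code e \<Longrightarrow> \<exists>p. code p = e"
  proof (induction e rule: less_induct)
    case (less e)
    define t a where "t = pfst e" and "a = psnd e"
    have e: "e = pair t a" by (simp add: t_def a_def)
    have c: "code_cond is_code e" using less.prems by (simp add: is_code_unfold[symmetric])
    show ?case
    proof (cases "t < 5")
      case True
      then have "a = 0" "t = 0 \<or> t = 1 \<or> t = 2 \<or> t = 3 \<or> t = 4"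
        using c by (auto simp: code_cond_def t_def[symmetric] a_def[symmetric])
      then show ?thesis unfolding e by (metis code.simps(1-5))
    next
      case False
      then have lt: "a < e" unfolding a_def t_def by (intro psnd_less) simp
      show ?thesis
      proof (cases "t = 8")
        case True
        then have "is_code a" using c by (auto simp: code_cond_def t_def[symmetric] a_def[symmetric])
        then obtain p where "code p = a" using less.IH lt by blast
        then show ?thesis using True unfolding e by (intro exI[of _ "MuP p"]) simp
      next
        case F: False
        then have t: "t = 5 \<or> t = 6 \<or> t = 7" and "is_code (pfst a)" "is_code (psnd a)"
          using c False by (auto simp: code_cond_def t_def[symmetric] a_def[symmetric])
        moreover have "pfst a < e" "psnd a < e" using lt pfst_le psnd_le by (blast intro: le_less_trans)+
        ultimately obtain p q where "code p = pfst a" "code q = psnd a" using less.IH by metis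
        then have "a = pair (code p) (code q)" by simp
        then show ?thesis using t unfolding e by (metis code.simps(6-8))
      qed
    qed
  qed
qed

text \<open>States: \<open>Ev e n k\<close> evaluates the program with code \<open>e\<close> at \<open>n\<close>, and \<open>Rt v k\<close> returns \<open>v\<close>
  to the stack \<open>k\<close>, which is \<open>0\<close> if empty. The frames of the stack have tags 6 and 2 for the two components
  of a pair, 3 for composition, 4 for recursion and 5 for minimisation.\<close>

abbreviation (input) Ev :: "nat \<Rightarrow> nat \<Rightarrow> nat \<Rightarrow> nat" where
  "Ev e n k \<equiv> pair 0 (pair e (pair n k))"

abbreviation (input) Rt :: "nat \<Rightarrow> nat \<Rightarrow> nat" where
  "Rt v k \<equiv> pair 2 (pair 0 (pair v k))"

abbreviation (input) push :: "nat \<Rightarrow> nat \<Rightarrow> nat \<Rightarrow> nat" where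
  "push t d k \<equiv> Suc (pair (pair t d) k)"

definition ev_step :: "cantor \<Rightarrow> nat \<Rightarrow> nat \<Rightarrow> nat \<Rightarrow> nat" where
  "ev_step A e n k =
     (if pfst e = 0 then Rt 0 k
      else if pfst e = 1 then Rt (Suc n) k
      else if pfst e = 2 then Rt (pfst n) k
      else if pfst e = 3 then Rt (psnd n) k
      else if pfst e = 4 then Rt (of_bool (A n)) k
      else if pfst e = 5 then Ev (pfst (psnd e)) n (push 6 (pair (psnd (psnd e)) n) k)
      else if pfst e = 6 then Ev (psnd (psnd e)) n (push 3 (pfst (psnd e)) k)
      else if pfst e = 7 then
        Ev (pfst (psnd e)) (pfst n) (push 4 (pair (psnd (psnd e)) (pair (pfst n) (pair 0 (psnd n)))) k)
      else Ev (psnd e) (pair n 0) (push 5 (pair (psnd e) (pair n 0)) k))"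

definition rt_frame :: "nat \<Rightarrow> nat \<Rightarrow> nat \<Rightarrow> nat \<Rightarrow> nat" where
  "rt_frame v t d k =
     (if t = 6 then Ev (pfst d) (psnd d) (push 2 v k)
      else if t = 2 then Rt (pair d v) k
      else if t = 3 then Ev d v k
      else if t = 4 then
        if pfst (psnd (psnd d)) = psnd (psnd (psnd d)) then Rt v k
        else Ev (pfst d) (pair (pfst (psnd d)) (pair (pfst (psnd (psnd d))) v))
          (push 4 (pair (pfst d) (pair (pfst (psnd d))
            (pair (Suc (pfst (psnd (psnd d)))) (psnd (psnd (psnd d)))))) k)
      else if v = 0 then Rt (psnd (psnd d)) k
      else Ev (pfst d) (pair (pfst (psnd d)) (Suc (psnd (psnd d))))
        (push 5 (pair (pfst d) (pair (pfst (psnd d)) (Suc (psnd (psnd d))))) k))"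

definition rt_step :: "nat \<Rightarrow> nat \<Rightarrow> nat" where
  "rt_step v k =
     (if k = 0 then Rt v 0
      else rt_frame v (pfst (pfst (k - 1))) (psnd (pfst (k - 1))) (psnd (k - 1)))"

definition step :: "cantor \<Rightarrow> nat \<Rightarrow> nat" where
  "step A x =
     (if pfst x = 0 then ev_step A (pfst (psnd x)) (pfst (psnd (psnd x))) (psnd (psnd (psnd x)))
      else rt_step (pfst (psnd (psnd x))) (psnd (psnd (psnd x))))"

lemma step_Ev: "step A (Ev e n k) = ev_step A e n k"
  by (simp add: step_def)

lemma step_Rt_push: "step A (Rt v (push t d k)) = rt_frame v t d k"
  by (simp add: step_def rt_step_def)

lemma step_Rt_0: "step A (Rt v 0) = Rt v 0"
  by (simp add: step_def rt_step_def)

lemmas step_simps = step_Ev step_Rt_push step_Rt_0 ev_step_def rt_frame_def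

lemma rec_in_step:
  assumes B: "dec2_in A B" and f: "rec_in A f"
  shows "rec_in A (\<lambda>x. step (B x) (f x))"
  unfolding step_def ev_step_def rt_frame_def rt_step_def
  by (intro rec_intros dec_in_comp2[OF B] f)

lemma rec_in_steps:
  assumes B: "dec2_in A B" and f: "rec_in A f" and t: "rec_in A t"
  shows "rec_in A (\<lambda>x. (step (B x) ^^ t x) (f x))"
proof -
  have "(step (B x) ^^ k) y = rec_nat y (\<lambda>_ y. step (B x) y) k" for x y k
    by (induction k) simp_all
  then have eq: "(\<lambda>x. (step (B x) ^^ t x) (f x)) = (\<lambda>x. rec_nat (f x) (\<lambda>_ y. step (B x) y) (t x))"
    by (intro ext)
  show ?thesis unfolding eq
    by (intro rec_in_rec rec_in_step dec_in_comp2[OF B] f t rec_intros)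
qed

section \<open>Correctness of the machine\<close>

definition reaches :: "cantor \<Rightarrow> nat \<Rightarrow> nat \<Rightarrow> bool" where
  "reaches A x y \<longleftrightarrow> (\<exists>t. (step A ^^ t) x = y)"

lemma reaches_refl: "reaches A x x"
  unfolding reaches_def by (rule exI[of _ 0]) simp

lemma reaches_step: "reaches A (step A x) y \<Longrightarrow> reaches A x y"
  unfolding reaches_def by (metis funpow_Suc_right o_apply)

lemma reaches_trans: "reaches A x y \<Longrightarrow> reaches A y z \<Longrightarrow> reaches A x z"
  unfolding reaches_def by (metis funpow_add o_apply)

text \<open>The stack \<open>k\<close> is arbitrary so that the induction hypothesis applies on top
  of the frames pushed meanwhile.\<close>

lemma run_imp_reaches: "run A p n = Some v \<Longrightarrow> reaches A (Ev (code p) n k) (Rt v k)"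
proof (induction p arbitrary: n v k)
  case (PairP p q)
  then obtain x y where x: "run A p n = Some x" and y: "run A q n = Some y" and v: "v = pair x y"
    by (auto simp: bind_eq_Some_conv)
  have "reaches A (Rt y (push 2 x k)) (Rt v k)"
    by (rule reaches_step) (simp add: step_simps v reaches_refl)
  from reaches_trans[OF PairP.IH(2)[OF y] this]
  have "reaches A (Rt x (push 6 (pair (code q) n) k)) (Rt v k)"
    by (intro reaches_step[of _ "Rt x _"]) (simp add: step_simps)
  from reaches_trans[OF PairP.IH(1)[OF x] this] show ?case
    by (intro reaches_step[of _ "Ev _ _ _"]) (simp add: step_simps)
next
  case (CompP p q)
  then obtain x where x: "run A q n = Some x" and v: "run A p x = Some v"
    by (auto simp: bind_eq_Some_conv)
  have "reaches A (Rt x (push 3 (code p) k)) (Rt v k)"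
    by (rule reaches_step) (simp add: step_simps CompP.IH(1)[OF v])
  from reaches_trans[OF CompP.IH(2)[OF x] this] show ?case
    by (intro reaches_step[of _ "Ev _ _ _"]) (simp add: step_simps)
next
  case (RecP p q)
  define a j where "a = pfst n" and "j = psnd n"
  define fr where "fr i = push 4 (pair (code q) (pair a (pair i j))) k" for i
  define f where "f = rec_nat (run A p a) (\<lambda>k r. Option.bind r (\<lambda>y. run A q (pair a (pair k y))))"
  have fv: "f j = Some v" using RecP.prems by (simp add: f_def a_def j_def)
  \<comment> \<open>Loop invariant: after \<open>i\<close> rounds the top frame carries the counter
    \<open>i\<close> and the value for \<open>i\<close> is being returned. Divergence in an earlier
    round would persist up to \<open>j\<close>.\<close>
  have *: "\<exists>y. f i = Some y \<and> reaches A (Ev (code p) a (fr 0)) (Rt y (fr i))" if "i \<le> j" for i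
    using that
  proof (induction i)
    case 0
    have "f 0 \<noteq> None"
    proof
      assume "f 0 = None"
      then have "f m = None" for m by (induction m) (auto simp: f_def)
      with fv show False by simp
    qed
    then obtain y where "run A p a = Some y" by (auto simp: f_def)
    then show ?case using RecP.IH(1) by (auto simp: f_def)
  next
    case (Suc i)
    then obtain y where y: "f i = Some y" "reaches A (Ev (code p) a (fr 0)) (Rt y (fr i))" by auto
    have "f (Suc i) \<noteq> None"
    proof
      assume N: "f (Suc i) = None"
      have "f (Suc i + m) = None" for m by (induction m) (use N in \<open>auto simp: f_def\<close>)
      from this[of "j - Suc i"] fv Suc.prems show False by simp
    qed
    then obtain z where z: "f (Suc i) = Some z" by blast
    then have "run A q (pair a (pair i y)) = Some z" using y by (simp add: f_def)
    from RecP.IH(2)[OF this] have "reaches A (Rt y (fr i)) (Rt z (fr (Suc i)))"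
      using Suc.prems by (intro reaches_step[of _ "Rt _ _"]) (simp add: step_simps fr_def)
    then show ?case using z y(2) reaches_trans by blast
  qed
  from *[of j] fv have "reaches A (Ev (code p) a (fr 0)) (Rt v (fr j))" by auto
  moreover have "reaches A (Rt v (fr j)) (Rt v k)"
    by (intro reaches_step[of _ "Rt _ _"]) (simp add: step_simps fr_def reaches_refl)
  ultimately have "reaches A (Ev (code p) a (fr 0)) (Rt v k)" by (rule reaches_trans)
  then show ?case
    by (intro reaches_step[of _ "Ev _ _ _"]) (simp add: step_simps fr_def a_def j_def)
next
  case (MuP p)
  define fr where "fr i = push 5 (pair (code p) (pair n i)) k" for i
  obtain m where m: "run A p (pair n m) = Some 0" "\<forall>j<m. run A p (pair n j) \<noteq> None"
    and v: "v = (LEAST m. run A p (pair n m) = Some 0)"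
    using MuP.prems by (auto split: if_splits)
  have v0: "run A p (pair n v) = Some 0" unfolding v by (rule LeastI) (rule m(1))
  have vm: "v \<le> m" unfolding v by (rule Least_le) (rule m(1))
  have *: "reaches A (Ev (code p) (pair n 0) (fr 0)) (Ev (code p) (pair n i) (fr i))" if "i \<le> v" for i
    using that
  proof (induction i)
    case 0
    show ?case by (rule reaches_refl)
  next
    case (Suc i)
    then have "run A p (pair n i) \<noteq> None" using m(2) vm by auto
    moreover have "run A p (pair n i) \<noteq> Some 0" 
      using Suc.prems not_less_Least[of i "\<lambda>m. run A p (pair n m) = Some 0"] unfolding v by simp
    ultimately obtain y where y: "run A p (pair n i) = Some y" "y \<noteq> 0" by auto
    have "reaches A (Rt y (fr i)) (Ev (code p) (pair n (Suc i)) (fr (Suc i)))"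
      using y by (intro reaches_step[of _ "Rt _ _"]) (simp add: step_simps fr_def reaches_refl)
    from reaches_trans[OF MuP.IH[OF y(1)] this] Suc show ?case by (simp add: reaches_trans[of A "Ev _ _ _"])
  qed
  have "reaches A (Rt 0 (fr v)) (Rt v k)"
    by (intro reaches_step[of _ "Rt _ _"]) (simp add: step_simps fr_def reaches_refl)
  with MuP.IH[OF v0] *[of v] have "reaches A (Ev (code p) (pair n 0) (fr 0)) (Rt v k)"
    by (blast intro: reaches_trans)
  then show ?case
    by (intro reaches_step[of _ "Ev _ _ _"]) (simp add: step_simps fr_def)
qed (rule reaches_step, simp add: step_simps reaches_refl)+

text \<open>A return to the empty stack is a fixed point of \<open>step\<close>, so halting after
  exactly \<open>t\<close> steps amounts to halting within \<open>t\<close> steps.\<close>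

definition halts_in :: "cantor \<Rightarrow> nat \<Rightarrow> nat \<Rightarrow> bool" where
  "halts_in A t x \<longleftrightarrow> (\<exists>v. (step A ^^ t) x = Rt v 0)"

lemma halts_in_Suc: "halts_in A (Suc t) x \<longleftrightarrow> halts_in A t (step A x)"
  by (simp add: halts_in_def funpow_Suc_right del: funpow.simps)

lemma halts_in_Ev: "halts_in A t (Ev e n k) \<Longrightarrow> \<exists>t'. t = Suc t' \<and> halts_in A t' (ev_step A e n k)"
  by (cases t) (auto simp: halts_in_Suc step_Ev, auto simp: halts_in_def)

lemma halts_in_Rt:
  "halts_in A t (Rt v (push u d k)) \<Longrightarrow> \<exists>t'. t = Suc t' \<and> halts_in A t' (rt_frame v u d k)"
  by (cases t) (auto simp: halts_in_Suc step_Rt_push, auto simp: halts_in_def)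

text \<open>Induction on the running time rather than on the program: each subevaluation ends with
  strictly fewer steps left, which also bounds the loops of recursion and minimisation.\<close>

lemma halts_in_imp_run:
  "halts_in A t (Ev (code p) n k) \<Longrightarrow> \<exists>v s. s < t \<and> run A p n = Some v \<and> halts_in A s (Rt v k)"
proof (induction t arbitrary: p n k rule: less_induct)
  case (less t)
  obtain t' where t: "t = Suc t'" and t': "halts_in A t' (ev_step A (code p) n k)"
    using halts_in_Ev[OF less.prems] by blast
  show ?case
  proof (cases p)
    case (PairP p q)
    have "halts_in A t' (Ev (code p) n (push 6 (pair (code q) n) k))"
      using t' by (simp add: PairP ev_step_def)
    then obtain x s where s: "s < t'" "run A p n = Some x"
      and 1: "halts_in A s (Rt x (push 6 (pair (code q) n) k))"
      using less.IH[of t'] t by blast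
    obtain s' where s': "s = Suc s'" and "halts_in A s' (Ev (code q) n (push 2 x k))"
      using halts_in_Rt[OF 1] by (auto simp: rt_frame_def)
    then obtain y u where u: "u < s'" "run A q n = Some y" and 2: "halts_in A u (Rt y (push 2 x k))"
      using less.IH[of s'] s(1) t by fastforce
    obtain u' where "u = Suc u'" "halts_in A u' (Rt (pair x y) k)"
      using halts_in_Rt[OF 2] by (auto simp: rt_frame_def)
    then show ?thesis using s u s' t by (intro exI[of _ "pair x y"] exI[of _ u']) (simp add: PairP)
  next
    case (CompP p q)
    have "halts_in A t' (Ev (code q) n (push 3 (code p) k))"
      using t' by (simp add: CompP ev_step_def)
    then obtain x s where s: "s < t'" "run A q n = Some x"
      and 1: "halts_in A s (Rt x (push 3 (code p) k))"
      using less.IH[of t'] t by blast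
    obtain s' where s': "s = Suc s'" and "halts_in A s' (Ev (code p) x k)"
      using halts_in_Rt[OF 1] by (auto simp: rt_frame_def)
    then obtain y u where u: "u < s'" "run A p x = Some y" and 2: "halts_in A u (Rt y k)"
      using less.IH[of s'] s(1) t by fastforce
    then show ?thesis using s s' t by (intro exI[of _ y] exI[of _ u]) (simp add: CompP)
  next
    case (RecP p q)
    define a j where "a = pfst n" and "j = psnd n"
    define fr where "fr i = push 4 (pair (code q) (pair a (pair i j))) k" for i
    define f where "f = rec_nat (run A p a) (\<lambda>k r. Option.bind r (\<lambda>y. run A q (pair a (pair k y))))"
    have *: "\<exists>v u. u < t' \<and> f j = Some v \<and> halts_in A u (Rt v k)"
      if "halts_in A s (Rt y (fr i))" "f i = Some y" "s < t'" "i \<le> j" for s y i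
      using that
    proof (induction "j - i" arbitrary: i y s)
      case 0
      then obtain s' where "s = Suc s'" "halts_in A s' (Rt y k)"
        using halts_in_Rt[OF 0(2)[unfolded fr_def]] by (auto simp: rt_frame_def)
      then show ?case using 0 by (intro exI[of _ y] exI[of _ s']) auto
    next
      case (Suc d)
      then have "i \<noteq> j" by auto
      then obtain s' where s': "s = Suc s'" "halts_in A s' (Ev (code q) (pair a (pair i y)) (fr (Suc i)))"
        using halts_in_Rt[OF Suc.prems(1)[unfolded fr_def]] by (auto simp: rt_frame_def fr_def)
      then obtain z u where "u < s'" "run A q (pair a (pair i y)) = Some z" "halts_in A u (Rt z (fr (Suc i)))"
        using less.IH[of s'] t \<open>s < t'\<close> by fastforce
      then show ?case using Suc s' by (intro Suc.hyps(1)[of "Suc i" u z]) (auto simp: f_def)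
    qed
    have "halts_in A t' (Ev (code p) a (fr 0))"
      using t' by (simp add: RecP ev_step_def fr_def a_def j_def)
    then obtain y s where "s < t'" "run A p a = Some y" "halts_in A s (Rt y (fr 0))"
      using less.IH[of t'] t by blast
    then obtain v u where "u < t'" "f j = Some v" "halts_in A u (Rt v k)"
      using *[of s y 0] by (auto simp: f_def)
    then show ?thesis using t by (intro exI[of _ v] exI[of _ u]) (simp add: RecP f_def a_def j_def)
  next
    case (MuP p)
    define fr where "fr i = push 5 (pair (code p) (pair n i)) k" for i
    have *: "\<exists>v u. u < t \<and> run A (MuP p) n = Some v \<and> halts_in A u (Rt v k)"
      if "halts_in A s (Ev (code p) (pair n i) (fr i))" "s < t"
        "\<forall>j<i. run A p (pair n j) \<noteq> None \<and> run A p (pair n j) \<noteq> Some 0" for s i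
      using that
    proof (induction s arbitrary: i rule: less_induct)
      case (less s)
      obtain x u where u: "u < s" "run A p (pair n i) = Some x" and 1: "halts_in A u (Rt x (fr i))"
        using \<open>\<And>y p n k. y < t \<Longrightarrow> halts_in A y (Ev (code p) n k) \<Longrightarrow> _\<close>[of s p "pair n i" "fr i"]
          less.prems by blast
      show ?case
      proof (cases "x = 0")
        case True
        then obtain u' where u': "u = Suc u'" "halts_in A u' (Rt i k)"
          using halts_in_Rt[OF 1[unfolded fr_def]] by (auto simp: rt_frame_def)
        have "(LEAST m. run A p (pair n m) = Some 0) = i"
          using u(2) True less.prems(3) by (intro Least_equality) (auto simp: not_less[symmetric])
        moreover have "\<exists>m. run A p (pair n m) = Some 0 \<and> (\<forall>j<m. run A p (pair n j) \<noteq> None)"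
          using u(2) True less.prems(3) by blast
        ultimately have "run A (MuP p) n = Some i" by simp
        then show ?thesis using u u' less.prems(2) by (intro exI[of _ i] exI[of _ u']) auto
      next
        case False
        then obtain u' where u': "u = Suc u'" "halts_in A u' (Ev (code p) (pair n (Suc i)) (fr (Suc i)))"
          using halts_in_Rt[OF 1[unfolded fr_def]] by (auto simp: rt_frame_def fr_def)
        then show ?thesis
          using u less.prems False by (intro less.IH[of u' "Suc i"]) (auto simp: less_Suc_eq)
      qed
    qed
    have "halts_in A t' (Ev (code p) (pair n 0) (fr 0))"
      using t' by (simp add: MuP ev_step_def fr_def)
    with *[of t' 0] t show ?thesis by (simp add: MuP)
  qed (use t t' in \<open>auto simp: ev_step_def\<close>)
qed

lemma halts_in_mono: "halts_in A s x \<Longrightarrow> s \<le> t \<Longrightarrow> halts_in A t x"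
proof -
  assume "halts_in A s x" "s \<le> t"
  then obtain v where v: "(step A ^^ s) x = Rt v 0" by (auto simp: halts_in_def)
  have "(step A ^^ d) (Rt v 0) = Rt v 0" for d by (induction d) (simp_all add: step_Rt_0)
  then have "(step A ^^ ((t - s) + s)) x = Rt v 0" unfolding funpow_add by (simp add: v)
  with \<open>s \<le> t\<close> show ?thesis by (auto simp: halts_in_def)
qed

lemma run_iff_halts: "run A p n \<noteq> None \<longleftrightarrow> (\<exists>t. halts_in A t (Ev (code p) n 0))"
  using halts_in_imp_run[of A _ p n 0] run_imp_reaches[of A p n _ 0]
  by (force simp: reaches_def halts_in_def)

lemma dec_in_halts_in:
  assumes B: "dec2_in A B" and f: "rec_in A f" and t: "rec_in A t"
  shows "dec_in A (\<lambda>x. halts_in (B x) (t x) (f x))"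
proof -
  \<comment> \<open>The returned value need not be searched for, as it can be read off the
    state.\<close>
  have *: "(\<exists>v. y = Rt v 0) \<longleftrightarrow> y = Rt (pfst (psnd (psnd y))) 0" for y by auto
  show ?thesis unfolding halts_in_def * by (intro rec_intros rec_in_steps assms)
qed

section \<open>Stages of enumerations and the limit lemma\<close>

lemma ce_set_stages:
  assumes "ce_set S"
  obtains H where "dec2_in no_oracle H" "\<And>n. n \<in> S \<longleftrightarrow> (\<exists>t. H n t)" "\<And>n s t. H n s \<Longrightarrow> s \<le> t \<Longrightarrow> H n t"
proof -
  obtain p where p: "\<forall>n. n \<in> S \<longleftrightarrow> run no_oracle p n \<noteq> None" using assms by (auto simp: ce_set_def)
  show thesis
  proof (rule that)
    show "dec2_in no_oracle (\<lambda>n t. halts_in no_oracle t (Ev (code p) n 0))"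
      by (intro rec_intros dec_in_halts_in)
  qed (use p run_iff_halts halts_in_mono in auto)
qed

text \<open>A single step asks the oracle at most one question, so a computation of fixed length is
  settled by a good enough approximation to the oracle.\<close>

lemma eventually_steps:
  assumes K: "\<And>n. eventually (\<lambda>s. K s n = A n) F"
  shows "eventually (\<lambda>s. (step (K s) ^^ t) x = (step A ^^ t) x) F"
proof (induction t)
  case (Suc t)
  have aux: "B (pfst (psnd (psnd y))) = A (pfst (psnd (psnd y))) \<Longrightarrow> step B y = step A y" for B y
    by (simp add: step_def ev_step_def)
  let ?y = "(step A ^^ t) x"
  from Suc K[of "pfst (psnd (psnd ?y))"] show ?case
    by eventually_elim (simp add: aux[of "K _"])
qed simp

text \<open>One direction of Shoenfield's limit lemma: at stage \<open>s\<close> the reduction is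
  run for \<open>s\<close> steps, with the programs that have halted within \<open>s\<close> steps
  as oracle.\<close>

lemma limit_lemma:
  assumes "X \<le>\<^sub>T halting"
  obtains Xs where "dec2_in no_oracle Xs" "\<And>n. eventually (\<lambda>t. Xs t n = X n) sequentially"
proof -
  \<comment> \<open>The machine also runs on numbers that code no program, while
    \<open>halting\<close> holds of codes only; hence the test \<open>is_code\<close>.\<close>
  define K where "K s e \<longleftrightarrow> is_code e \<and> halts_in no_oracle s (Ev e e 0)" for s e
  have "eventually (\<lambda>s. K s e = halting e) sequentially" for e
  proof (cases "halting e")
    case True
    then obtain p where p: "code p = e" "run no_oracle p e \<noteq> None" by (auto simp: halting_def)
    then obtain t where "halts_in no_oracle t (Ev e e 0)" using run_iff_halts[of no_oracle p e] by auto
    then have "K s e" if "t \<le> s" for s using p(1) halts_in_mono that by (auto simp: K_def is_code_iff)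
    then show ?thesis using True by (auto intro: eventually_sequentiallyI[of t])
  next
    case False
    have "\<not> K s e" for s
    proof
      assume "K s e"
      then obtain p where "code p = e" "halts_in no_oracle s (Ev (code p) e 0)"
        by (auto simp: K_def is_code_iff)
      then show False using False run_iff_halts[of no_oracle p e] by (auto simp: halting_def)
    qed
    then show ?thesis using False by simp
  qed
  note K = this
  obtain p where p: "\<forall>n. run halting p n = Some (of_bool (X n))"
    using assms by (auto simp: turing_reducible_def)
  define Xs where "Xs s n \<longleftrightarrow> (step (K s) ^^ s) (Ev (code p) n 0) = Rt 1 0" for s n
  show thesis
  proof (rule that)
    have code: "dec_in no_oracle (\<lambda>x. is_code (f x))" if "rec_in no_oracle f" for f
      unfolding is_code_def course_rec_def code_cond_def
      by (intro rec_intros rec_in_hist that)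
    show "dec2_in no_oracle Xs"
      unfolding Xs_def K_def by (intro rec_intros rec_in_steps dec_in_halts_in code)
    fix n
    obtain t where t: "(step halting ^^ t) (Ev (code p) n 0) = Rt (of_bool (X n)) 0"
      using run_imp_reaches[of halting p n _ 0] p by (auto simp: reaches_def)
    have fin: "(step A ^^ d) (Rt v 0) = Rt v 0" for A d v by (induction d) (simp_all add: step_Rt_0)
    have "eventually (\<lambda>s. (step (K s) ^^ t) (Ev (code p) n 0) = (step halting ^^ t) (Ev (code p) n 0)) sequentially"
      by (rule eventually_steps) (rule K)
    then
    show "eventually (\<lambda>t. Xs t n = X n) sequentially"
      using eventually_ge_at_top[of t]
    proof eventually_elim
      case (elim s)
      have "(step (K s) ^^ ((s - t) + t)) (Ev (code p) n 0) = Rt (of_bool (X n)) 0"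
        unfolding funpow_add using elim t fin by simp
      then show ?case using elim(2) by (simp add: Xs_def)
    qed
  qed
qed

section \<open>Effectively open sets by decidable predicates on prefixes\<close>

definition dec3_in :: "cantor \<Rightarrow> (nat \<Rightarrow> nat \<Rightarrow> nat \<Rightarrow> bool) \<Rightarrow> bool" where
  "dec3_in A P \<longleftrightarrow> dec_in A (\<lambda>x. P (pfst x) (pfst (psnd x)) (psnd (psnd x)))"

lemma dec3_inI: "dec_in A (\<lambda>x. P (pfst x) (pfst (psnd x)) (psnd (psnd x))) \<Longrightarrow> dec3_in A P"
  by (simp add: dec3_in_def)

lemma dec_in_comp3:
  assumes P: "dec3_in A P" and f: "rec_in A f" "rec_in A g" "rec_in A h"
  shows "dec_in A (\<lambda>x. P (f x) (g x) (h x))"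
proof -
  have "rec_in A (\<lambda>x. pair (f x) (pair (g x) (h x)))" by (intro rec_in_pair f)
  from dec_in_comp[OF P[unfolded dec3_in_def] this] show ?thesis by simp
qed

text \<open>\<open>bits _ s\<close> and \<open>snum\<close> are inverse bijections between the
  numbers below \<open>2 ^ s\<close> and the strings of length \<open>s\<close>; quantifiers over
  strings thus become bounded quantifiers over numbers.\<close>

definition bits :: "nat \<Rightarrow> nat \<Rightarrow> bool list" where
  "bits z s = map (bit z) [0..<s]"

definition snum :: "bool list \<Rightarrow> nat" where
  "snum \<sigma> = num (\<lambda>i. \<sigma> ! i) (length \<sigma>)"

lemma length_bits [simp]: "length (bits z s) = s"
  by (simp add: bits_def)

lemma nth_bits [simp]: "i < s \<Longrightarrow> bits z s ! i = bit z i"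
  by (simp add: bits_def)

lemma snum_less: "snum \<sigma> < 2 ^ length \<sigma>"
  by (simp add: snum_def num_less)

lemma bits_snum: "bits (snum \<sigma>) (length \<sigma>) = \<sigma>"
  by (rule nth_equalityI) (simp_all add: snum_def bit_num)

lemma snum_bits: "z < 2 ^ s \<Longrightarrow> snum (bits z s) = z"
  using num_eq_iff[of "\<lambda>i. bits z s ! i" s "bit z"] by (simp add: snum_def num_bit_less)

lemma string_code_inject: "string_code \<sigma> = string_code \<tau> \<longleftrightarrow> \<sigma> = \<tau>"
proof -
  have "inj (of_bool :: bool \<Rightarrow> nat)" by (rule injI) (simp add: of_bool_def split: if_splits)
  then show ?thesis by (simp add: string_code_def list_encode_eq inj_map_eq_map)
qed

lemma length_le_list_encode: "length xs \<le> list_encode xs"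
proof (induction xs)
  case (Cons x xs)
  then show ?case using le_prod_encode_2[of "list_encode xs" x] by simp
qed simp

lemma length_le_string_code: "length \<sigma> \<le> string_code \<sigma>"
  using length_le_list_encode[of "map of_bool \<sigma>"] by (simp add: string_code_def)

lemma mem_cylinder_iff: "Z \<in> cylinder \<sigma> \<longleftrightarrow> num Z (length \<sigma>) = snum \<sigma>"
  by (auto simp: cylinder_def snum_def num_eq_iff)

lemma rec_in_string_code:
  assumes z: "rec_in A z" and s: "rec_in A s"
  shows "rec_in A (\<lambda>x. string_code (bits (z x) (s x)))"
proof -
  \<comment> \<open>\<open>list_encode\<close> builds the code from the end of the list, hence round
    \<open>k\<close> prepends the bit at \<open>n - Suc k\<close>.\<close>
  have *: "rec_nat 0 (\<lambda>k y. Suc (pair (of_bool (bit m (n - Suc k))) y)) k =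
      list_encode (map (of_bool \<circ> bit m) [n - k..<n])" if "k \<le> n" for m n k
    using that
  proof (induction k)
    case (Suc k)
    then have "[n - Suc k..<n] = (n - Suc k) # [n - k..<n]"
      by (subst upt_conv_Cons) (simp_all add: Suc_diff_Suc)
    with Suc show ?case by simp
  qed simp
  have eq: "(\<lambda>x. string_code (bits (z x) (s x))) =
      (\<lambda>x. rec_nat 0 (\<lambda>k y. Suc (pair (of_bool (bit (z x) (s x - Suc k))) y)) (s x))"
    by (rule ext) (simp add: * string_code_def bits_def)
  show ?thesis unfolding eq
    by (intro rec_in_rec s rec_intros rec_in_comp[OF z] rec_in_comp[OF s])
qed

lemma string_code_bits_iff:
  "z < 2 ^ s \<Longrightarrow> string_code (bits z s) = string_code \<sigma> \<longleftrightarrow> s = length \<sigma> \<and> z = snum \<sigma>"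
  by (metis bits_snum length_bits snum_bits string_code_inject)

lemma pair_string_code_mem_iff:
  "pair i (string_code \<sigma>) \<in> (\<lambda>(i, \<sigma>). prod_encode (i, string_code \<sigma>)) ` W \<longleftrightarrow> (i, \<sigma>) \<in> W"
proof
  assume "(i, \<sigma>) \<in> W"
  then show "pair i (string_code \<sigma>) \<in> (\<lambda>(i, \<sigma>). prod_encode (i, string_code \<sigma>)) ` W"
    by (rule rev_image_eqI) simp
qed (auto simp: string_code_inject)

lemma ce_set_decidable:
  assumes "dec_in no_oracle D"
  shows "ce_set {n. D n}"
proof -
  have "rec_in no_oracle (\<lambda>z. of_bool (\<not> D (pfst z)))"
    by (intro rec_intros dec_in_comp[OF assms])
  then obtain p where p: "\<forall>z. run no_oracle p z = Some (of_bool (\<not> D (pfst z)))"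
    unfolding rec_in_def by blast
  show ?thesis unfolding ce_set_def by (rule exI[of _ "MuP p"]) (simp add: p)
qed

text \<open>Stage \<open>s\<close> accepts a prefix if one of its initial segments has been
  enumerated within \<open>s\<close> steps. Waiting long enough for both the length and the
  enumeration replaces enumerability by decidability.\<close>

lemma uniformly_sigma01_decidable:
  assumes "uniformly_sigma01 U"
  obtains T where "dec3_in no_oracle T" "\<And>i. U i = {Z. \<exists>s. T i s (num Z s)}"
proof -
  from assms obtain W :: "(nat \<times> bool list) set" where
    ce: "ce_set ((\<lambda>(i, \<sigma>). prod_encode (i, string_code \<sigma>)) ` W)" and
    U: "\<And>i. U i = (\<Union>\<sigma>\<in>{\<sigma>. (i, \<sigma>) \<in> W}. cylinder \<sigma>)"
    unfolding uniformly_sigma01_def by blast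
  obtain H where H: "dec2_in no_oracle H" "\<And>n. n \<in> (\<lambda>(i, \<sigma>). prod_encode (i, string_code \<sigma>)) ` W \<longleftrightarrow> (\<exists>t. H n t)"
    "\<And>n s t. H n s \<Longrightarrow> s \<le> t \<Longrightarrow> H n t"
    by (rule ce_set_stages[OF ce]) (rule that)
  have W: "(i, \<sigma>) \<in> W \<longleftrightarrow> (\<exists>t. H (pair i (string_code \<sigma>)) t)" for i \<sigma>
    unfolding H(2)[symmetric] pair_string_code_mem_iff ..
  define T where "T i s z \<longleftrightarrow> (\<exists>j\<le>s. H (pair i (string_code (bits z j))) s)" for i s z
  show thesis
  proof (rule that)
    show "dec3_in no_oracle T"
      unfolding T_def by (intro dec3_inI rec_intros dec_in_comp2[OF H(1)] rec_in_string_code)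
    have nb: "bits (num Z s) j = bits (num Z j) j" if "j \<le> s" for Z s j
      using that by (intro nth_equalityI) (auto simp: bit_num)
    have cyl: "Z \<in> cylinder (bits (num Z j) j)" for Z j
      by (simp add: mem_cylinder_iff snum_bits num_less)
    show "U i = {Z. \<exists>s. T i s (num Z s)}" for i
    proof (intro equalityI subsetI)
      fix Z assume "Z \<in> U i"
      then obtain \<sigma> where \<sigma>: "(i, \<sigma>) \<in> W" "Z \<in> cylinder \<sigma>" unfolding U by blast
      then obtain t where t: "H (pair i (string_code \<sigma>)) t" using W by blast
      have "bits (num Z (length \<sigma>)) (length \<sigma>) = \<sigma>"
        using \<sigma>(2) by (simp add: mem_cylinder_iff bits_snum)
      then have "T i (max t (length \<sigma>)) (num Z (max t (length \<sigma>)))"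
        unfolding T_def using nb[of "length \<sigma>" "max t (length \<sigma>)" Z] H(3)[OF t]
        by (intro exI[of _ "length \<sigma>"]) simp
      then show "Z \<in> {Z. \<exists>s. T i s (num Z s)}" by blast
    next
      fix Z assume "Z \<in> {Z. \<exists>s. T i s (num Z s)}"
      then obtain s j where "j \<le> s" "H (pair i (string_code (bits (num Z s) j))) s"
        unfolding T_def by blast
      then have "(i, bits (num Z j) j) \<in> W" using nb[of j s Z] unfolding W by auto
      then show "Z \<in> U i" using cyl unfolding U by blast
    qed
  qed
qed

text \<open>The accepted strings form a decidable set: a code is decoded by searching through the
  strings whose length is at most the code.\<close>

lemma uniformly_sigma01I:
  assumes "dec3_in no_oracle T"
  shows "uniformly_sigma01 (\<lambda>i. {Z. \<exists>s. T i s (num Z s)})"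
  unfolding uniformly_sigma01_def
proof (intro exI conjI allI)
  let ?W = "{(i, \<sigma>). T i (length \<sigma>) (snum \<sigma>)}"
  define D where "D n \<longleftrightarrow> (\<exists>s\<le>psnd n. \<exists>z<2 ^ s. string_code (bits z s) = psnd n \<and> T (pfst n) s z)" for n
  have "dec_in no_oracle D"
    unfolding D_def by (intro rec_intros rec_in_string_code dec_in_comp3[OF assms])
  moreover have "(\<lambda>(i, \<sigma>). prod_encode (i, string_code \<sigma>)) ` ?W = {n. D n}"
  proof (intro equalityI subsetI)
    fix n assume "n \<in> (\<lambda>(i, \<sigma>). prod_encode (i, string_code \<sigma>)) ` ?W"
    then obtain i \<sigma> where "n = pair i (string_code \<sigma>)" "T i (length \<sigma>) (snum \<sigma>)" by auto
    then show "n \<in> {n. D n}"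
      unfolding D_def using length_le_string_code[of \<sigma>] snum_less[of \<sigma>]
      by (simp, intro exI[of _ "length \<sigma>"] conjI exI[of _ "snum \<sigma>"]) (simp_all add: bits_snum)
  next
    fix n assume "n \<in> {n. D n}"
    then obtain s z where "z < 2 ^ s" "string_code (bits z s) = psnd n" "T (pfst n) s z"
      unfolding D_def by blast
    then show "n \<in> (\<lambda>(i, \<sigma>). prod_encode (i, string_code \<sigma>)) ` ?W"
      by (intro image_eqI[of _ _ "(pfst n, bits z s)"]) (auto simp: snum_bits)
  qed
  ultimately show "ce_set ((\<lambda>(i, \<sigma>). prod_encode (i, string_code \<sigma>)) ` ?W)"
    using ce_set_decidable by metis
next
  fix i
  show "{Z. \<exists>s. T i s (num Z s)} = (\<Union>\<sigma>\<in>{\<sigma>. (i, \<sigma>) \<in> {(i, \<sigma>). T i (length \<sigma>) (snum \<sigma>)}}. cylinder \<sigma>)"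
  proof (intro equalityI subsetI)
    fix Z assume "Z \<in> {Z. \<exists>s. T i s (num Z s)}"
    then obtain s where "T i s (num Z s)" by blast
    then show "Z \<in> (\<Union>\<sigma>\<in>{\<sigma>. (i, \<sigma>) \<in> {(i, \<sigma>). T i (length \<sigma>) (snum \<sigma>)}}. cylinder \<sigma>)"
      by (intro UN_I[of "bits (num Z s) s"]) (simp_all add: snum_bits num_less mem_cylinder_iff)
  next
    fix Z assume "Z \<in> (\<Union>\<sigma>\<in>{\<sigma>. (i, \<sigma>) \<in> {(i, \<sigma>). T i (length \<sigma>) (snum \<sigma>)}}. cylinder \<sigma>)"
    then obtain \<sigma> where "T i (length \<sigma>) (snum \<sigma>)" "Z \<in> cylinder \<sigma>" by blast
    then show "Z \<in> {Z. \<exists>s. T i s (num Z s)}" 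
      by (intro CollectI exI[of _ "length \<sigma>"]) (simp add: mem_cylinder_iff)
  qed
qed

text \<open>Regarding the complement as a constant sequence makes the two preceding normal forms
  available for classes.\<close>

lemma pi01_class_iff_sigma: "pi01_class P \<longleftrightarrow> uniformly_sigma01 (\<lambda>_. - P)"
proof
  assume "pi01_class P"
  then obtain W :: "bool list set" where W: "ce_set (string_code ` W)" "P = - (\<Union>\<sigma>\<in>W. cylinder \<sigma>)"
    unfolding pi01_class_def by blast
  from W(1) obtain p where p: "\<forall>n. n \<in> string_code ` W \<longleftrightarrow> run no_oracle p n \<noteq> None"
    unfolding ce_set_def by blast
  have mem: "n \<in> (\<lambda>(i, \<sigma>). prod_encode (i, string_code \<sigma>)) ` (UNIV \<times> W) \<longleftrightarrow> psnd n \<in> string_code ` W"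
    for n by (auto simp: image_iff) (metis prod.collapse prod_decode_inverse)
  show "uniformly_sigma01 (\<lambda>_. - P)"
    unfolding uniformly_sigma01_def
  proof (intro exI[of _ "UNIV \<times> W"] conjI)
    show "ce_set ((\<lambda>(i, \<sigma>). prod_encode (i, string_code \<sigma>)) ` (UNIV \<times> W))"
      unfolding ce_set_def mem by (rule exI[of _ "CompP p SndP"]) (simp add: p)
  qed (simp add: W(2))
next
  assume "uniformly_sigma01 (\<lambda>_. - P)"
  then obtain W :: "(nat \<times> bool list) set" where
    W: "ce_set ((\<lambda>(i, \<sigma>). prod_encode (i, string_code \<sigma>)) ` W)"
    "- P = (\<Union>\<sigma>\<in>{\<sigma>. (0, \<sigma>) \<in> W}. cylinder \<sigma>)"
    unfolding uniformly_sigma01_def by blast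
  from W(1) obtain p where
    p: "\<forall>n. n \<in> (\<lambda>(i, \<sigma>). prod_encode (i, string_code \<sigma>)) ` W \<longleftrightarrow> run no_oracle p n \<noteq> None"
    unfolding ce_set_def by blast
  have mem: "n \<in> string_code ` {\<sigma>. (0, \<sigma>) \<in> W} \<longleftrightarrow> pair 0 n \<in> (\<lambda>(i, \<sigma>). prod_encode (i, string_code \<sigma>)) ` W"
    for n
  proof
    assume "n \<in> string_code ` {\<sigma>. (0, \<sigma>) \<in> W}"
    then show "pair 0 n \<in> (\<lambda>(i, \<sigma>). prod_encode (i, string_code \<sigma>)) ` W"
      by (auto simp: pair_string_code_mem_iff)
  qed auto
  show "pi01_class P"
    unfolding pi01_class_def
  proof (intro exI[of _ "{\<sigma>. (0, \<sigma>) \<in> W}"] conjI)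
    show "ce_set (string_code ` {\<sigma>. (0, \<sigma>) \<in> W})"
      unfolding ce_set_def mem
      \<comment> \<open>\<open>PairP FstP SndP\<close> is the identity, so the inner program
        computes \<open>pair 0 n\<close>.\<close>
      by (rule exI[of _ "CompP p (PairP ZeroP (PairP FstP SndP))"]) (simp add: p)
    show "P = - (\<Union>\<sigma>\<in>{\<sigma>. (0, \<sigma>) \<in> W}. cylinder \<sigma>)" using W(2) by blast
  qed
qed

lemma pi01_class_decidable:
  assumes "pi01_class P"
  obtains T where "dec2_in no_oracle T" "P = {Z. \<forall>s. T s (num Z s)}"
proof -
  obtain T where T: "dec3_in no_oracle T" and U: "\<And>i::nat. - P = {Z. \<exists>s. T i s (num Z s)}"
    by (rule uniformly_sigma01_decidable[OF assms[unfolded pi01_class_iff_sigma]]) (rule that)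
  show thesis
  proof (rule that)
    show "dec2_in no_oracle (\<lambda>s z. \<not> T 0 s z)"
      by (intro rec_intros dec_in_comp3[OF T])
    show "P = {Z. \<forall>s. \<not> T 0 s (num Z s)}" using U[of 0] by auto
  qed
qed

lemma pi01_classI:
  assumes "dec2_in no_oracle T"
  shows "pi01_class {Z. \<forall>s. T s (num Z s)}"
proof -
  have "dec3_in no_oracle (\<lambda>i s z. \<not> T s z)"
    by (intro dec3_inI rec_intros dec_in_comp2[OF assms])
  from uniformly_sigma01I[OF this] show ?thesis
    unfolding pi01_class_iff_sigma by (simp add: Collect_neg_eq[symmetric])
qed

text \<open>The values are exact dyadic rationals, so a single fraction serves for every
  precision.\<close>

lemma computable_real_fun_dyadic:
  assumes cnt: "rec2_in no_oracle cnt"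
    and g: "\<And>\<sigma>. g \<sigma> = real (cnt (length \<sigma>) (snum \<sigma>)) / 2 ^ length \<sigma>"
  shows "computable_real_fun g"
proof -
  \<comment> \<open>The argument comes as a string code; summing over all strings of length at most
    the code picks out the one with that code.\<close>
  define dec where "dec f c = (\<Sum>s<Suc c. \<Sum>z<2 ^ s. of_bool (string_code (bits z s) = c) * f s z)"
    for f :: "nat \<Rightarrow> nat \<Rightarrow> nat" and c
  have dec: "dec f (string_code \<sigma>) = f (length \<sigma>) (snum \<sigma>)" for f \<sigma>
  proof -
    have "(\<Sum>z<2 ^ s. of_bool (string_code (bits z s) = string_code \<sigma>) * f s z) =
        of_bool (s = length \<sigma>) * f s (snum \<sigma>)" for s
    proof -
      have "(\<Sum>z<2 ^ s. of_bool (string_code (bits z s) = string_code \<sigma>) * f s z) =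
          (\<Sum>z<2 ^ s. if z = snum \<sigma> then of_bool (s = length \<sigma>) * f s (snum \<sigma>) else 0)"
        by (intro sum.cong) (auto simp: string_code_bits_iff)
      also have "\<dots> = of_bool (s = length \<sigma>) * f s (snum \<sigma>)"
        using snum_less[of \<sigma>] by (auto simp: sum.delta)
      finally show ?thesis .
    qed
    then have "dec f (string_code \<sigma>) = (\<Sum>s<Suc (string_code \<sigma>). if s = length \<sigma> then f s (snum \<sigma>) else 0)"
      unfolding dec_def by (intro sum.cong) auto
    also have "\<dots> = f (length \<sigma>) (snum \<sigma>)"
      using length_le_string_code[of \<sigma>] by (subst sum.delta) auto
    finally show ?thesis .
  qed
  have rec: "rec_in no_oracle (\<lambda>x. dec f (pfst x))" if "rec2_in no_oracle f" for f
    unfolding dec_def by (intro rec_intros rec_in_string_code rec_in_comp2[OF that])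
  show ?thesis
    unfolding computable_real_fun_def computable_fun_iff
  proof (intro exI conjI allI)
    show "rec_in no_oracle (\<lambda>x. dec cnt (pfst x))" by (rule rec[OF cnt])
    show "rec_in no_oracle (\<lambda>_. 0)" by (rule rec_in_const)
    \<comment> \<open>The denominator in the definition is \<open>c + 1\<close>, hence the shift by
      one.\<close>
    show "rec_in no_oracle (\<lambda>x. dec (\<lambda>s _. 2 ^ s - 1) (pfst x))" by (intro rec rec_intros)
    show "let x = prod_encode (string_code \<sigma>, n) in
        \<bar>g \<sigma> - (real (dec cnt (pfst x)) - real 0) / (real (dec (\<lambda>s _. 2 ^ s - 1) (pfst x)) + 1)\<bar> \<le> 1 / 2 ^ n"
      for \<sigma> n by (simp add: dec g of_nat_diff)
  qed
qed

section \<open>Topology and Lebesgue measure of Cantor space\<close>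

lemma compact_space_cantor: "compact_space (euclidean :: cantor topology)"
proof -
  have "compact_space (euclidean :: bool topology)"
    by (simp add: compact_space_def finite_imp_compact)
  then show ?thesis
    unfolding euclidean_product_topology[symmetric] compact_space_product_topology by blast
qed

lemma open_num: "open {Z. P (num Z s)}"
proof -
  have "open {Z :: cantor. \<forall>n\<in>{..<s}. Z n \<in> {bit z n}}" for z :: nat
    by (rule product_topology_basis') (simp_all add: Topological_Spaces.open_discrete)
  moreover have "{Z. P (num Z s)} = (\<Union>z\<in>{z. z < 2 ^ s \<and> P z}. {Z. \<forall>n\<in>{..<s}. Z n \<in> {bit z n}})"
  proof (intro equalityI subsetI)
    fix Z assume "Z \<in> {Z. P (num Z s)}"
    then show "Z \<in> (\<Union>z\<in>{z. z < 2 ^ s \<and> P z}. {Z. \<forall>n\<in>{..<s}. Z n \<in> {bit z n}})"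
      by (intro UN_I[of "num Z s"]) (simp_all add: num_less bit_num)
  next
    fix Z assume "Z \<in> (\<Union>z\<in>{z. z < 2 ^ s \<and> P z}. {Z. \<forall>n\<in>{..<s}. Z n \<in> {bit z n}})"
    then obtain z where z: "z < 2 ^ s" "P z" "\<forall>n<s. Z n = bit z n" by auto
    then have "num Z s = z" using num_eq_iff[of Z s "bit z"] num_bit_less by simp
    with z show "Z \<in> {Z. P (num Z s)}" by simp
  qed
  ultimately show ?thesis by auto
qed

lemma open_local:
  assumes "\<And>Z Z'. Q Z \<Longrightarrow> num Z s = num Z' s \<Longrightarrow> Q Z'"
  shows "open {Z. Q Z}"
proof -
  have "{Z. Q Z} = {Z. \<exists>Z'. num Z' s = num Z s \<and> Q Z'}" using assms by blast
  then show ?thesis using open_num[of "\<lambda>z. \<exists>Z'. num Z' s = z \<and> Q Z'" s] by simp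
qed

text \<open>Koenig's lemma in topological form: each condition depends on finitely many bits, hence
  defines a closed set, and these sets are nested.\<close>

lemma compactness:
  fixes Q :: "nat \<Rightarrow> cantor \<Rightarrow> bool"
  assumes ne: "\<And>s. \<exists>Z. Q s Z" and dec: "\<And>s Z. Q (Suc s) Z \<Longrightarrow> Q s Z"
    and loc: "\<And>s Z Z'. Q s Z \<Longrightarrow> num Z s = num Z' s \<Longrightarrow> Q s Z'"
  shows "\<exists>Z. \<forall>s. Q s Z"
proof -
  have "(\<Inter>s. {Z. Q s Z}) \<noteq> {}"
  proof (rule compact_space_imp_nest[OF compact_space_cantor])
    show "closedin euclidean {Z. Q s Z}" for s
    proof -
      have "open {Z. \<not> Q s Z}" by (rule open_local[where s = s]) (metis loc)
      then show ?thesis by (simp add: closed_def Collect_neg_eq)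
    qed
    show "decseq (\<lambda>s. {Z. Q s Z})" using dec by (intro decseq_SucI) blast
  qed (use ne in blast)
  then show ?thesis by blast
qed

lemma open_decidable_union: "open {Z. \<exists>s. P s (num Z s)}"
proof -
  have "{Z. \<exists>s. P s (num Z s)} = (\<Union>s. {Z. P s (num Z s)})" by blast
  then show ?thesis using open_num by auto
qed

section \<open>The fair coin measure of sets of prefixes\<close>

lemma product_prob_space_coin:
  "product_prob_space (\<lambda>_. measure_pmf (bernoulli_pmf (1 / 2)))"
  by unfold_locales

lemma space_cantor_lebesgue [simp]: "space cantor_lebesgue = UNIV"
  using sets_eq_imp_space_eq[OF sets_cantor_lebesgue] by simp

lemma prob_space_cantor_lebesgue: "prob_space cantor_lebesgue"
  unfolding cantor_lebesgue_def by (intro prob_space_PiM prob_space_measure_pmf)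

lemma sets_num: "{Z. P (num Z s)} \<in> sets cantor_lebesgue"
  unfolding sets_cantor_lebesgue by (intro borel_open open_num)

lemma measure_num_eq:
  assumes "z < 2 ^ s"
  shows "measure cantor_lebesgue {Z. num Z s = z} = 1 / 2 ^ s"
proof -
  interpret product_prob_space "\<lambda>_::nat. measure_pmf (bernoulli_pmf (1 / 2))" UNIV
    by (rule product_prob_space_coin)
  have "{Z. num Z s = z} = {Z \<in> space cantor_lebesgue. \<forall>i\<in>{..<s}. Z i \<in> {bit z i}}"
    using assms num_eq_iff[of _ s "bit z"] num_bit_less by auto
  then have "emeasure cantor_lebesgue {Z. num Z s = z} =
      (\<Prod>i<s. emeasure (measure_pmf (bernoulli_pmf (1 / 2))) {bit z i})"
    unfolding cantor_lebesgue_def by (simp only:) (rule emeasure_PiM_Collect, auto)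
  also have "\<dots> = (\<Prod>i<s. ennreal (1 / 2))"
  proof (intro prod.cong refl)
    fix i
    show "emeasure (measure_pmf (bernoulli_pmf (1 / 2))) {bit z i} = ennreal (1 / 2)"
      by (cases "bit z i") (simp_all add: emeasure_pmf_single)
  qed
  also have "\<dots> = ennreal (1 / 2 ^ s)"
    unfolding prod_constant card_lessThan by (subst ennreal_power) (simp_all add: power_one_over)
  finally show ?thesis by (simp add: measure_def)
qed

lemma measure_num:
  "measure cantor_lebesgue {Z. P (num Z s)} = real (card {z. z < 2 ^ s \<and> P z}) / 2 ^ s"
proof -
  interpret prob_space cantor_lebesgue by (rule prob_space_cantor_lebesgue)
  have "{Z. P (num Z s)} = (\<Union>z\<in>{z. z < 2 ^ s \<and> P z}. {Z. num Z s = z})"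
    using num_less by auto
  also have "measure cantor_lebesgue \<dots> = (\<Sum>z\<in>{z. z < 2 ^ s \<and> P z}. measure cantor_lebesgue {Z. num Z s = z})"
    using sets_num[of "\<lambda>w. w = _" s] by (intro finite_measure_finite_Union) (auto simp: disjoint_family_on_def)
  also have "\<dots> = real (card {z. z < 2 ^ s \<and> P z}) / 2 ^ s"
    by (simp add: measure_num_eq)
  finally show ?thesis .
qed

definition flip :: "cantor \<Rightarrow> cantor \<Rightarrow> cantor" where
  "flip E Z n \<longleftrightarrow> Z n \<noteq> E n"

lemma continuous_flip: "continuous_on UNIV (flip E)"
proof (rule continuous_on_coordinatewise_then_product)
  fix i
  have "continuous_on UNIV (\<lambda>b :: bool. b \<noteq> E i)"
    by (simp add: continuous_on_open_vimage Topological_Spaces.open_discrete)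
  moreover have "continuous_on UNIV (\<lambda>Z :: cantor. Z i)" by simp
  ultimately have "continuous_on UNIV ((\<lambda>b. b \<noteq> E i) \<circ> (\<lambda>Z. Z i))"
    by (intro continuous_on_compose) (auto intro: continuous_on_subset)
  then show "continuous_on UNIV (\<lambda>Z. flip E Z i)" by (simp add: flip_def comp_def)
qed

lemma measurable_flip: "flip E \<in> measurable cantor_lebesgue cantor_lebesgue"
  using borel_measurable_continuous_onI[OF continuous_flip]
  by (simp cong: measurable_cong_sets add: sets_cantor_lebesgue)

text \<open>A product measure is determined by its values on boxes; in each coordinate a flip
  permutes the two outcomes, which a fair coin gives equal weight.\<close>

lemma distr_flip: "distr cantor_lebesgue cantor_lebesgue (flip E) = cantor_lebesgue"
proof -
  let ?M = "\<lambda>_::nat. measure_pmf (bernoulli_pmf (1 / 2))"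
  interpret product_prob_space ?M UNIV by (rule product_prob_space_coin)
  show ?thesis
    unfolding cantor_lebesgue_def
  proof (rule PiM_eq)
    fix J :: "nat set" and F :: "nat \<Rightarrow> bool set"
    assume J: "finite J"
    define G where "G j = {b. (b \<noteq> E j) \<in> F j}" for j
    have 1: "prod_emb UNIV ?M J (\<Pi>\<^sub>E j\<in>J. H j) = {Z. \<forall>j\<in>J. Z j \<in> H j}" for H
      by (auto simp: prod_emb_def PiE_iff)
    have "flip E -` {Z. \<forall>j\<in>J. Z j \<in> F j} = {Z. \<forall>j\<in>J. Z j \<in> G j}"
      by (auto simp: flip_def G_def)
    moreover have "{Z. \<forall>j\<in>J. Z j \<in> F j} \<in> sets (PiM UNIV ?M)"
      unfolding 1[symmetric] using J by (intro sets_PiM_I) auto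
    ultimately have "emeasure (distr (PiM UNIV ?M) (PiM UNIV ?M) (flip E)) (prod_emb UNIV ?M J (\<Pi>\<^sub>E j\<in>J. F j)) =
        emeasure (PiM UNIV ?M) (prod_emb UNIV ?M J (\<Pi>\<^sub>E j\<in>J. G j))"
      using J measurable_flip[of E, unfolded cantor_lebesgue_def]
      unfolding 1 by (subst emeasure_distr) (simp_all add: space_PiM)
    also have "\<dots> = (\<Prod>j\<in>J. emeasure (?M j) (G j))"
      using J by (intro emeasure_PiM_emb) auto
    also have "\<dots> = (\<Prod>j\<in>J. emeasure (?M j) (F j))"
    proof (intro prod.cong refl)
      fix j
      have e: "emeasure (?M j) S = ennreal (real (card S) / 2)" for S
      proof -
        have "pmf (bernoulli_pmf (1 / 2)) b = 1 / 2" for b by (cases b) simp_all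
        then show ?thesis by (subst emeasure_measure_pmf_finite) auto
      qed
      have "bij_betw (\<lambda>b. b \<noteq> E j) (G j) (F j)"
        by (cases "E j"; rule bij_betwI[where g = "\<lambda>b. b \<noteq> E j"]) (auto simp: G_def)
      then show "emeasure (?M j) (G j) = emeasure (?M j) (F j)"
        unfolding e by (simp add: bij_betw_same_card)
    qed
    finally show "emeasure (distr (PiM UNIV ?M) (PiM UNIV ?M) (flip E)) (prod_emb UNIV ?M J (\<Pi>\<^sub>E j\<in>J. F j)) =
        (\<Prod>j\<in>J. emeasure (?M j) (F j))" .
  qed simp
qed

lemma measure_flip:
  assumes "A \<in> sets cantor_lebesgue"
  shows "measure cantor_lebesgue {Z. flip E Z \<in> A} = measure cantor_lebesgue A"
  using measure_distr[OF measurable_flip assms, of E] by (simp add: distr_flip vimage_def)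

text \<open>Flipping the bits in the various subsets of \<open>C\<close> below \<open>m\<close> yields pairwise disjoint copies of \<open>A\<close>.\<close>

lemma measure_selection_le:
  assumes A: "A \<in> sets cantor_lebesgue" and C: "i \<le> card {n. n < m \<and> C n}"
    and sel: "\<And>Z Z' n. Z \<in> A \<Longrightarrow> Z' \<in> A \<Longrightarrow> (\<And>n. \<not> C n \<Longrightarrow> Z n = Z' n) \<Longrightarrow> n < m \<Longrightarrow> Z n = Z' n"
  shows "measure cantor_lebesgue A \<le> 1 / 2 ^ i"
proof -
  interpret prob_space cantor_lebesgue by (rule prob_space_cantor_lebesgue)
  let ?D = "{n. n < m \<and> C n}"
  define B where "B E = {Z. flip (\<lambda>n. n \<in> E) Z \<in> A}" for E
  have "disjoint_family_on B (Pow ?D)"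
    unfolding disjoint_family_on_def
  proof (intro ballI impI)
    fix E E' assume E: "E \<in> Pow ?D" "E' \<in> Pow ?D" "E \<noteq> E'"
    show "B E \<inter> B E' = {}"
    proof (rule ccontr)
      assume "B E \<inter> B E' \<noteq> {}"
      then obtain Z where Z: "flip (\<lambda>n. n \<in> E) Z \<in> A" "flip (\<lambda>n. n \<in> E') Z \<in> A"
        by (auto simp: B_def)
      \<comment> \<open>Two copies meeting in \<open>Z\<close> yield two members of \<open>A\<close>
        that agree off \<open>C\<close>; as they then agree below \<open>m\<close>, no bit was
        flipped in one copy only.\<close>
      have "flip (\<lambda>n. n \<in> E) Z n = flip (\<lambda>n. n \<in> E') Z n" if "n < m" for n
        by (rule sel[OF Z _ that]) (use E in \<open>auto simp: flip_def\<close>)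
      then have "n \<in> E \<longleftrightarrow> n \<in> E'" if "n < m" for n using that by (auto simp: flip_def)
      then show False using E by blast
    qed
  qed
  moreover have Bs: "B E \<in> sets cantor_lebesgue" for E
    using measurable_sets[OF measurable_flip A, of "\<lambda>n. n \<in> E"] by (simp add: B_def vimage_def)
  ultimately have "measure cantor_lebesgue (\<Union>E\<in>Pow ?D. B E) = (\<Sum>E\<in>Pow ?D. measure cantor_lebesgue (B E))"
    by (intro finite_measure_finite_Union) auto
  also have "\<dots> = 2 ^ card ?D * measure cantor_lebesgue A"
    by (simp add: B_def measure_flip[OF A] card_Pow)
  finally have "2 ^ card ?D * measure cantor_lebesgue A \<le> 1" using prob_le_1 by metis
  moreover have "(2 :: real) ^ i * measure cantor_lebesgue A \<le> 2 ^ card ?D * measure cantor_lebesgue A"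
    using C by (intro mult_right_mono power_increasing) auto
  ultimately show ?thesis by (simp add: field_simps)
qed

text \<open>The test consists of the sequences \<open>Z\<close> for which it is seen at some stage that all sequences
  surviving in the class and agreeing with \<open>Z\<close> off \<open>C\<close> also agree with \<open>Z\<close> on \<open>i\<close> elements of \<open>C\<close>.\<close>

lemma ml_random_other_member:
  assumes X: "ml_random cantor_lebesgue X" and T: "dec2_in no_oracle T" and C: "dec_in no_oracle C"
    and inf: "infinite {n. C n}" and XT: "\<And>s. T s (num X s)"
  shows "\<exists>V. V \<noteq> X \<and> (\<forall>n. \<not> C n \<longrightarrow> V n = X n) \<and> (\<forall>s. T s (num V s))"
proof (rule ccontr)
  assume none: "\<not> ?thesis"
  define cnt where "cnt m = (\<Sum>n<m. of_bool (C n) :: nat)" for m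
  have cnt: "cnt m = card {n. n < m \<and> C n}" for m
    by (simp add: cnt_def sum_of_bool_eq Int_def)
  have ex: "\<exists>m. i \<le> cnt m" for i
  proof -
    obtain F where F: "F \<subseteq> {n. C n}" "card F = i" "finite F" using infinite_arbitrarily_large[OF inf] by blast
    then have "F \<subseteq> {n. n < Suc (Max F) \<and> C n}" by (auto simp: less_Suc_eq_le)
    then have "i \<le> cnt (Suc (Max F))" unfolding cnt using F(2) by (metis card_mono finite_Collect_conjI finite_Collect_less_nat)
    then show ?thesis ..
  qed
  \<comment> \<open>The elements of \<open>C\<close> below \<open>g i\<close>, at least
    \<open>i\<close> in number, are the bits to be determined; this yields the bound
    \<open>1 / 2 ^ i\<close>.\<close>
  define g where "g i = (LEAST m. i \<le> cnt m)" for i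
  have g: "i \<le> cnt (g i)" for i unfolding g_def using ex by (rule LeastI_ex)
  define tr where "tr s z \<longleftrightarrow> (\<forall>j\<le>s. T j (num (bit z) j))" for s z :: nat
  define S where "S i s z \<longleftrightarrow> g i \<le> s \<and> tr s z \<and>
    (\<forall>w<2 ^ s. tr s w \<and> (\<forall>n<s. \<not> C n \<longrightarrow> bit w n = bit z n) \<longrightarrow> (\<forall>n<g i. bit w n = bit z n))" for i s z :: nat
  define U where "U i = {Z. \<exists>s. S i s (num Z s)}" for i
  have num2: "num (bit (num Z s)) j = num Z j" if "j \<le> s" for Z s j
    using that by (auto simp: num_eq_iff bit_num)
  have tr: "tr s (num Z s) \<longleftrightarrow> (\<forall>j\<le>s. T j (num Z j))" for Z s
    by (auto simp: tr_def num2)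
  have Sn: "S i s (num Z s) \<longleftrightarrow> g i \<le> s \<and> (\<forall>j\<le>s. T j (num Z j)) \<and>
    (\<forall>Z'. (\<forall>j\<le>s. T j (num Z' j)) \<and> (\<forall>n<s. \<not> C n \<longrightarrow> Z' n = Z n) \<longrightarrow> (\<forall>n<g i. Z' n = Z n))" for i s Z
  proof -
    have *: "(\<forall>w<2 ^ s. Q w) \<longleftrightarrow> (\<forall>Z'. Q (num Z' s))" for Q
    proof
      assume Q: "\<forall>Z'. Q (num Z' s)"
      show "\<forall>w<2 ^ s. Q w"
      proof (intro allI impI)
        fix w :: nat assume "w < 2 ^ s"
        then show "Q w" using Q[rule_format, of "bit w"] by (simp add: num_bit_less)
      qed
    qed (use num_less in blast)
    show ?thesis
    proof (cases "g i \<le> s")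
      case True
      then have "n < g i \<Longrightarrow> n < s" for n by simp
      then show ?thesis unfolding S_def tr * by (simp add: bit_num)
    qed (simp add: S_def)
  qed
  have "ml_test cantor_lebesgue U"
    unfolding ml_test_def
  proof
    have gr: "rec_in no_oracle g"
      unfolding g_def cnt_def
      by (rule rec_in_LEAST[OF _ ex[unfolded cnt_def]]) (intro rec_intros dec_in_comp[OF C])
    have "dec3_in no_oracle S"
      unfolding S_def tr_def
      by (intro dec3_inI rec_intros rec_in_num rec_in_comp[OF gr] dec_in_comp[OF C] dec_in_comp2[OF T])
    from uniformly_sigma01I[OF this] show "uniformly_sigma01 U" unfolding U_def .
    show "\<forall>i. measure cantor_lebesgue (U i) \<le> 1 / 2 ^ i"
    proof (intro allI measure_selection_le)
      fix i
      show "U i \<in> sets cantor_lebesgue"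
        unfolding U_def sets_cantor_lebesgue by (intro borel_open open_decidable_union)
      show "i \<le> card {n. n < g i \<and> C n}" using g cnt by simp
      \<comment> \<open>The earlier of the two stages decides: a sequence accepted at the later
        stage also survives at the earlier one, so it is among the sequences compared there.\<close>
      have sel: "Z n = Z' n" if "S i s (num Z s)" "S i s' (num Z' s')" "s \<le> s'"
        "\<And>n. \<not> C n \<Longrightarrow> Z n = Z' n" "n < g i" for Z Z' s s' n
      proof -
        have "\<forall>j\<le>s. T j (num Z' j)" using that(2,3) unfolding Sn by auto
        moreover have "\<forall>n<s. \<not> C n \<longrightarrow> Z' n = Z n" using that(4) by blast
        ultimately have "Z' n = Z n" using that(1,5) unfolding Sn by blast
        then show ?thesis ..
      qed
      fix Z Z' n
      assume "Z \<in> U i" "Z' \<in> U i" and eq: "\<And>n. \<not> C n \<Longrightarrow> Z n = Z' n" and n: "n < g i"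
      then obtain s s' where s: "S i s (num Z s)" "S i s' (num Z' s')" unfolding U_def by blast
      show "Z n = Z' n"
      proof (cases "s \<le> s'")
        case True
        from sel[OF s True eq n] show ?thesis .
      next
        case False
        then show ?thesis using sel[OF s(2,1) _ eq[symmetric] n] by simp
      qed
    qed
  qed
  with X have "X \<notin> (\<Inter>i. U i)" unfolding ml_random_def by blast
  then obtain i where "X \<notin> U i" by blast
  \<comment> \<open>Since \<open>X\<close> survives at every stage, it avoids \<open>U i\<close>
    only if at each late stage some survivor agrees with it off \<open>C\<close> and differs below
    \<open>g i\<close>.\<close>
  then have bad: "\<exists>Z'. (\<forall>j\<le>s. T j (num Z' j)) \<and> (\<forall>n<s. \<not> C n \<longrightarrow> Z' n = X n) \<and> (\<exists>n<g i. Z' n \<noteq> X n)"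
    if "g i \<le> s" for s
    using that XT unfolding U_def Sn by blast
  \<comment> \<open>The difference occurs below the fixed length \<open>g i\<close>, so it is not
    lost in the limit obtained by compactness.\<close>
  define Q where "Q s Z \<longleftrightarrow> (\<forall>j\<le>s. T j (num Z j)) \<and> (\<forall>n<s. \<not> C n \<longrightarrow> Z n = X n) \<and>
    (g i \<le> s \<longrightarrow> (\<exists>n<g i. Z n \<noteq> X n))" for s Z
  have "\<exists>Z. \<forall>s. Q s Z"
  proof (rule compactness)
    fix s
    obtain Z where "\<forall>j\<le>max s (g i). T j (num Z j)" "\<forall>n<max s (g i). \<not> C n \<longrightarrow> Z n = X n"
      "\<exists>n<g i. Z n \<noteq> X n"
      using bad[of "max s (g i)"] by auto
    then have "Q s Z" unfolding Q_def by simp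
    then show "\<exists>Z. Q s Z" by blast
  next
    fix s Z
    show "Q (Suc s) Z \<Longrightarrow> Q s Z" unfolding Q_def by auto
  next
    fix s Z Z' assume Q: "Q s Z" and eq: "num Z s = num Z' s"
    have "num Z j = num Z' j" if "j \<le> s" for j using eq that by (auto simp: num_eq_iff)
    moreover have "Z n = Z' n" if "n < s" for n using eq that by (auto simp: num_eq_iff)
    ultimately show "Q s Z'" using Q unfolding Q_def by (auto dest: less_le_trans)
  qed
  then obtain V where V: "Q s V" for s by blast
  have "V \<noteq> X" using V[of "g i"] by (auto simp: Q_def)
  moreover have "V n = X n" if "\<not> C n" for n using V[of "Suc n"] that by (auto simp: Q_def)
  moreover have "T s (num V s)" for s using V[of s] by (auto simp: Q_def)
  ultimately show False using none by blast
qed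

section \<open>Ordinals and Cantor-Bendixson derivatives\<close>

lemma ordinal_eq_iff: "\<gamma> = \<delta> \<longleftrightarrow> (rep_ordinal \<gamma>, rep_ordinal \<delta>) \<in> ordIso"
  using Quotient_rel_rep[OF Quotient_ordinal] by simp

lemma Well_order_rep_ordinal: "Well_order (rep_ordinal \<gamma>)"
  using Quotient_rep_reflp[OF Quotient_ordinal, of \<gamma>] unfolding ordIso_def by simp

lemma ordinal_abs_rep:
  fixes s :: "cantor rel"
  assumes "Well_order s"
  shows "(rep_ordinal (abs_ordinal s), s) \<in> ordIso"
  using Quotient_rep_abs[OF Quotient_ordinal] ordIso_reflexive[OF assms] by blast

text \<open>\<open>f b\<close> is the order type of the initial segment below \<open>b\<close>.\<close>

lemma order_type_segments:
  assumes r: "Well_order r" and \<alpha>: "has_order_type r \<alpha>"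
  obtains f where "\<And>b. b \<in> Field r \<Longrightarrow> f b < \<alpha>" "\<And>\<gamma>. \<gamma> < \<alpha> \<Longrightarrow> \<exists>b\<in>Field r. f b = \<gamma>"
    "\<And>b c. (b, c) \<in> r \<Longrightarrow> b \<noteq> c \<Longrightarrow> f b < f c"
proof -
  let ?R = "\<lambda>b. Restr r (underS r b)"
  have r\<alpha>: "(r, rep_ordinal \<alpha>) \<in> ordIso" using \<alpha> by (simp add: has_order_type.rep_eq)
  define f where "f b = (SOME \<gamma>. (rep_ordinal \<gamma>, ?R b) \<in> ordIso)" for b
  have lt: "(?R b, r) \<in> ordLess" if "b \<in> Field r" for b
    using underS_Restr_ordLess[OF r] that by auto
  have f: "(rep_ordinal (f b), ?R b) \<in> ordIso" if b: "b \<in> Field r" for b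
  proof -
    \<comment> \<open>\<open>r\<close> relates numbers, whereas ordinals are represented on
      \<open>cantor\<close>; comparison with the representative of \<alpha> moves the segment to
      that type.\<close>
    have "(?R b, rep_ordinal \<alpha>) \<in> ordLess" using lt[OF b] r\<alpha> by (rule ordLess_ordIso_trans)
    moreover have "Well_order (?R b)" by (rule Well_order_Restr[OF r])
    ultimately obtain a where
      a: "(?R b, Restr (rep_ordinal \<alpha>) (underS (rep_ordinal \<alpha>) a)) \<in> ordIso" (is "(_, ?s) \<in> _")
      using iffD1[OF ordLess_iff_ordIso_Restr[OF Well_order_rep_ordinal]] by blast
    have "Well_order ?s" by (rule Well_order_Restr[OF Well_order_rep_ordinal])
    from ordIso_transitive[OF ordinal_abs_rep[OF this] ordIso_symmetric[OF a]]
    show ?thesis unfolding f_def by (rule someI)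
  qed
  show thesis
  proof (rule that)
    fix b assume b: "b \<in> Field r"
    from ordIso_ordLess_trans[OF f[OF b] ordLess_ordIso_trans[OF lt[OF b] r\<alpha>]]
    show "f b < \<alpha>" by (simp add: less_ordinal.rep_eq)
  next
    fix \<gamma> assume "\<gamma> < \<alpha>"
    then have "(rep_ordinal \<gamma>, rep_ordinal \<alpha>) \<in> ordLess" by (simp add: less_ordinal.rep_eq)
    from ordLess_ordIso_trans[OF this ordIso_symmetric[OF r\<alpha>]]
    have "(rep_ordinal \<gamma>, r) \<in> ordLess" .
    then obtain b where b: "b \<in> Field r" "(rep_ordinal \<gamma>, ?R b) \<in> ordIso"
      using iffD1[OF ordLess_iff_ordIso_Restr[OF r Well_order_rep_ordinal]] by blast
    then have "f b = \<gamma>"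
      unfolding ordinal_eq_iff using ordIso_transitive[OF f[OF b(1)] ordIso_symmetric[OF b(2)]] by simp
    with b show "\<exists>b\<in>Field r. f b = \<gamma>" by blast
  next
    fix b c assume bc: "(b, c) \<in> r" "b \<noteq> c"
    then have F: "b \<in> Field r" "c \<in> Field r" by (auto intro: FieldI1 FieldI2)
    have wo: "wo_rel r" using r by (simp add: wo_rel_def)
    have "b \<in> underS r c" "b \<notin> underS r b" using bc by (auto simp: underS_def)
    moreover have "underS r b \<subseteq> underS r c"
      using bc wo_rel.TRANS[OF wo] wo_rel.ANTISYM[OF wo] by (auto simp: underS_def trans_def antisym_def)
    ultimately have "underS r b \<subset> underS r c" by blast
    then have "(?R b, ?R c) \<in> ordLess"
      by (rule iffD1[OF ofilter_subset_ordLess[OF r wo_rel.underS_ofilter[OF wo] wo_rel.underS_ofilter[OF wo]]])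
    from ordIso_ordLess_trans[OF f[OF F(1)] ordLess_ordIso_trans[OF this ordIso_symmetric[OF f[OF F(2)]]]]
    show "f b < f c" by (simp add: less_ordinal.rep_eq)
  qed
qed

section \<open>Iterated derivatives and ranks\<close>

lemma zero_le_ordinal: "(0 :: ordinal) \<le> \<gamma>"
  using not_less_zero_ordinal by (simp add: not_less[symmetric])

lemma cb_derivative_subset: "cb_derivative P \<subseteq> P"
  by (auto simp: cb_derivative_def)

text \<open>The three clauses of the definition become one condition, so later inductions need not
  distinguish zero, successors and limits.\<close>

lemma mem_iterated_derivative_iff:
  "X \<in> iterated_derivative P \<beta> \<longleftrightarrow>
     X \<in> P \<and> (\<forall>\<gamma><\<beta>. X \<in> cb_derivative (iterated_derivative P \<gamma>))"
proof (induction \<beta> rule: less_induct)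
  case (less \<beta>)
  consider "\<beta> = 0" | \<gamma> where "is_successor \<beta> \<gamma>" | "\<beta> \<noteq> 0" "\<nexists>\<gamma>. is_successor \<beta> \<gamma>" by blast
  then show ?case
  proof cases
    case 1
    then show ?thesis by (simp add: iterated_derivative_zero not_less_zero_ordinal)
  next
    case 2
    then have lt: "\<gamma> < \<beta>" and le: "\<And>\<delta>. \<delta> < \<beta> \<Longrightarrow> \<delta> \<le> \<gamma>" by (auto simp: is_successor_def)
    show ?thesis
    proof
      assume "X \<in> iterated_derivative P \<beta>"
      then have X: "X \<in> cb_derivative (iterated_derivative P \<gamma>)"
        by (simp add: iterated_derivative_successor[OF 2])
      then have "X \<in> iterated_derivative P \<gamma>" using cb_derivative_subset by blast
      with less.IH[OF lt] X le
      show "X \<in> P \<and> (\<forall>\<gamma><\<beta>. X \<in> cb_derivative (iterated_derivative P \<gamma>))"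
        by (metis order_le_less)
    next
      assume "X \<in> P \<and> (\<forall>\<gamma><\<beta>. X \<in> cb_derivative (iterated_derivative P \<gamma>))"
      then show "X \<in> iterated_derivative P \<beta>"
        using lt by (simp add: iterated_derivative_successor[OF 2])
    qed
  next
    case 3
    show ?thesis
    proof
      assume X: "X \<in> iterated_derivative P \<beta>"
      have "X \<in> iterated_derivative P 0"
        using X 3 zero_le_ordinal[of \<beta>] by (auto simp: iterated_derivative_limit[OF 3] order_le_less)
      moreover have "X \<in> cb_derivative (iterated_derivative P \<gamma>)" if "\<gamma> < \<beta>" for \<gamma>
      proof -
        \<comment> \<open>At a limit some \<delta> lies strictly between \<gamma> and \<beta>, and
          the induction hypothesis at \<delta> covers \<gamma>.\<close>
        have "\<not> is_successor \<beta> \<gamma>" using 3(2) by blast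
        then obtain \<delta> where \<delta>: "\<delta> < \<beta>" "\<gamma> < \<delta>"
          using \<open>\<gamma> < \<beta>\<close> by (auto simp: is_successor_def not_le)
        then have "X \<in> iterated_derivative P \<delta>" using X by (auto simp: iterated_derivative_limit[OF 3])
        then show ?thesis using less.IH[OF \<delta>(1)] \<delta>(2) by blast
      qed
      ultimately show "X \<in> P \<and> (\<forall>\<gamma><\<beta>. X \<in> cb_derivative (iterated_derivative P \<gamma>))"
        by (simp add: iterated_derivative_zero)
    next
      assume "X \<in> P \<and> (\<forall>\<gamma><\<beta>. X \<in> cb_derivative (iterated_derivative P \<gamma>))"
      then show "X \<in> iterated_derivative P \<beta>"
        using cb_derivative_subset by (auto simp: iterated_derivative_limit[OF 3])
    qed
  qed
qed

lemma open_contains_prefix: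
  fixes T :: "cantor set"
  assumes "open T" "X \<in> T"
  obtains m where "\<And>Y. num Y m = num X m \<Longrightarrow> Y \<in> T"
proof -
  have "openin (product_topology (\<lambda>i. euclidean) UNIV) T"
    using assms(1) by (simp add: euclidean_product_topology)
  from product_topology_open_contains_basis[OF this assms(2)]
  obtain U where U: "X \<in> (\<Pi>\<^sub>E i\<in>UNIV. U i)" "finite {i. U i \<noteq> UNIV}" "(\<Pi>\<^sub>E i\<in>UNIV. U i) \<subseteq> T" by auto
  obtain m where m: "\<And>i. U i \<noteq> UNIV \<Longrightarrow> i < m"
    using U(2) unfolding finite_nat_set_iff_bounded by blast
  show thesis
  proof (rule that)
    fix Y assume "num Y m = num X m"
    then have "Y i \<in> U i" for i using U(1) m by (cases "U i = UNIV") (auto simp: num_eq_iff PiE_iff)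
    then show "Y \<in> T" using U(3) by (auto simp: PiE_iff)
  qed
qed

text \<open>The sets of sequences with a common prefix form a neighbourhood basis, so accumulation
  can be tested on prefixes.\<close>

lemma mem_cb_derivative_iff:
  "X \<in> cb_derivative P \<longleftrightarrow> X \<in> P \<and> (\<forall>m. \<exists>Y\<in>P. Y \<noteq> X \<and> num Y m = num X m)"
proof -
  have "X isolated_in P \<longleftrightarrow> (\<exists>m. \<forall>Y\<in>P. num Y m = num X m \<longrightarrow> Y = X)" if X: "X \<in> P"
  proof
    assume "X isolated_in P"
    then obtain T where T: "open T" "T \<inter> P = {X}" by (auto simp: isolated_in_def)
    then have XT: "X \<in> T" by blast
    obtain m where "\<And>Y. num Y m = num X m \<Longrightarrow> Y \<in> T"
      using open_contains_prefix[OF T(1) XT] by blast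
    with T(2) show "\<exists>m. \<forall>Y\<in>P. num Y m = num X m \<longrightarrow> Y = X" by blast
  next
    assume "\<exists>m. \<forall>Y\<in>P. num Y m = num X m \<longrightarrow> Y = X"
    then obtain m where m: "\<And>Y. Y \<in> P \<Longrightarrow> num Y m = num X m \<Longrightarrow> Y = X" by blast
    have "open {Y. num Y m = num X m}"
      unfolding num_eq_iff
      using product_topology_basis'[of "{..<m}" "\<lambda>n. {X n}" "\<lambda>n. n"] by (simp add: Topological_Spaces.open_discrete Ball_def)
    with m X show "X isolated_in P"
      unfolding isolated_in_def by (intro conjI exI[of _ "{Y. num Y m = num X m}"]) auto
  qed
  then show ?thesis by (auto simp: cb_derivative_def)
qed

lemma exits_at_ge:
  assumes "X \<in> iterated_derivative P \<beta>" "exits_at P X \<gamma>"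
  shows "\<beta> \<le> \<gamma>"
  using assms mem_iterated_derivative_iff[of X P \<beta>] by (auto simp: exits_at_def not_less[symmetric])

lemma rank_in_eq: "exits_at P X \<beta> \<Longrightarrow> rank_in P X = \<beta>"
  unfolding rank_in_def
  by (rule Least_equality) (simp_all add: exits_at_ge[of X P \<beta>] exits_at_def)

text \<open>Survival up to \<beta> in every class bounds all ranks from below, and \<open>P\<close>
  attains the bound.\<close>

lemma cb_rank_eq:
  assumes P: "pi01_class P" "X \<in> P" and exits: "exits_at P X \<beta>"
    and lower: "\<And>Q. pi01_class Q \<Longrightarrow> X \<in> Q \<Longrightarrow> X \<in> iterated_derivative Q \<beta>"
  shows "cb_rank X = \<beta>"
  unfolding cb_rank_def
proof (rule Least_equality)
  show "\<exists>P. pi01_class P \<and> X \<in> P \<and> rank_in_defined P X \<and> rank_in P X = \<beta>"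
    using P exits rank_in_eq unfolding rank_in_defined_def by blast
next
  fix \<gamma>
  assume "\<exists>P. pi01_class P \<and> X \<in> P \<and> rank_in_defined P X \<and> rank_in P X = \<gamma>"
  then obtain Q where Q: "pi01_class Q" "X \<in> Q" "rank_in_defined Q X" "rank_in Q X = \<gamma>" by blast
  then have "exits_at Q X \<gamma>" using rank_in_eq unfolding rank_in_defined_def by blast
  then show "\<beta> \<le> \<gamma>" using exits_at_ge lower Q by blast
qed

section \<open>The functional\<close>

text \<open>Stage \<open>t\<close> serves column \<open>col t\<close>, and the level of a column is the length up to which it has been
  confirmed. Having to stay behind the smaller columns, a column stops when one of these does; only
  those with index below its level count, so that it waits for finitely many at a time.\<close>

definition lev :: "(nat \<Rightarrow> nat) \<Rightarrow> cantor \<Rightarrow> nat \<Rightarrow> nat \<Rightarrow> nat" where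
  "lev col Y c t = (\<Sum>s<t. of_bool (col s = c \<and> Y s))"

definition act :: "(nat \<Rightarrow> nat) \<Rightarrow> (nat \<Rightarrow> nat \<Rightarrow> bool) \<Rightarrow> (nat \<Rightarrow> cantor) \<Rightarrow> cantor \<Rightarrow> cantor \<Rightarrow> nat \<Rightarrow> bool" where
  "act col lt Xs Z Y t \<longleftrightarrow>
     (\<forall>d<lev col Y (col t) t. lt d (col t) \<longrightarrow> lev col Y (col t) t < lev col Y d t) \<and>
     (\<forall>n\<le>lev col Y (col t) t. col n = col t \<longrightarrow> Z n = Xs t n)"

lemma lev_Suc: "lev col Y c (Suc t) = lev col Y c t + of_bool (col t = c \<and> Y t)"
  by (simp add: lev_def)

lemma lev_le: "lev col Y c t \<le> t"
  by (induction t) (auto simp: lev_Suc lev_def)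

lemma lev_mono: "s \<le> t \<Longrightarrow> lev col Y c s \<le> lev col Y c t"
  by (induction t rule: dec_induct) (auto simp: lev_Suc)

lemma lev_cong: "(\<And>s. s < t \<Longrightarrow> Y s = Y' s) \<Longrightarrow> lev col Y c t = lev col Y' c t"
  by (simp add: lev_def)

lemma lev_attained: "k < lev col Y c t \<Longrightarrow> \<exists>s<t. col s = c \<and> Y s \<and> lev col Y c s = k"
proof (induction t)
  case (Suc t)
  show ?case
  proof (cases "k < lev col Y c t")
    case True
    with Suc show ?thesis using less_SucI by blast
  next
    case False
    with Suc.prems have "col t = c \<and> Y t \<and> lev col Y c t = k"
      by (cases "col t = c \<and> Y t") (auto simp: lev_Suc)
    then show ?thesis by blast
  qed
qed (simp add: lev_def)

text \<open>Stage \<open>t\<close> reads earlier outputs only, and of the input only the bits of its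
  column up to the level. The recursion for \<open>Phi\<close>, its continuity and its finite
  dependence all rest on this.\<close>

lemma act_cong:
  assumes "\<And>s. s < t \<Longrightarrow> Y s = Y' s"
    and "\<And>n. n \<le> lev col Y (col t) t \<Longrightarrow> col n = col t \<Longrightarrow> Z n = Z' n"
  shows "act col lt Xs Z Y t = act col lt Xs Z' Y' t"
proof -
  have "lev col Y' c t = lev col Y c t" for c using lev_cong[of t Y' Y] assms(1) by auto
  with assms(2) show ?thesis by (auto simp: act_def)
qed

text \<open>Position \<open>n\<close> belongs to column \<open>col n\<close>, which is served again
  at infinitely many stages; \<open>f c\<close> plays the order type of the columns below
  \<open>c\<close>. As \<open>f\<close> maps the columns bijectively onto the ordinals below
  \<alpha>, the two can be exchanged.\<close>

locale columns =
  fixes col :: "nat \<Rightarrow> nat" and lt :: "nat \<Rightarrow> nat \<Rightarrow> bool" and X :: cantor and Xs :: "nat \<Rightarrow> cantor"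
    and f :: "nat \<Rightarrow> ordinal" and \<alpha> :: ordinal
  assumes fibre: "infinite {t. col t = col n}"
    and lt_iff: "lt d c \<longleftrightarrow> d \<in> range col \<and> c \<in> range col \<and> f d < f c"
    and inj_f: "inj_on f (range col)"
    and f_less: "f (col n) < \<alpha>"
    and f_onto: "\<gamma> < \<alpha> \<Longrightarrow> \<exists>n. f (col n) = \<gamma>"
    and limit: "eventually (\<lambda>t. Xs t n = X n) sequentially"
begin

abbreviation "L \<equiv> lev col"

definition Phi :: "cantor \<Rightarrow> cantor" where
  "Phi Z = course_rec (act col lt Xs Z)"

lemma Phi_unfold: "Phi Z t = act col lt Xs Z (Phi Z) t"
  unfolding Phi_def by (rule course_rec_unfold) (rule act_cong, simp_all)

text \<open>A level never exceeds the number of past stages, so stage \<open>s\<close> reads no bit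
  beyond position \<open>s\<close>.\<close>

lemma Phi_prefix:
  assumes "num Z t = num Z' t"
  shows "num (Phi Z) t = num (Phi Z') t"
proof -
  have "s < t \<Longrightarrow> Phi Z s = Phi Z' s" for s
  proof (induction s rule: less_induct)
    case (less s)
    have "act col lt Xs Z (Phi Z) s = act col lt Xs Z' (Phi Z') s"
    proof (rule act_cong)
      fix n assume "n \<le> L (Phi Z) (col s) s"
      then have "n < t" using lev_le[of col "Phi Z" "col s" s] less.prems by simp
      with assms show "Z n = Z' n" by (simp add: num_eq_iff)
    qed (use less in auto)
    then show ?case by (simp add: Phi_unfold[symmetric])
  qed
  then show ?thesis by (simp add: num_eq_iff)
qed

section \<open>Columns that advance for ever\<close>

definition good :: "cantor \<Rightarrow> nat \<Rightarrow> bool" where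
  "good Z c \<longleftrightarrow> (\<forall>n. col n = c \<longrightarrow> Z n = X n)"

definition live :: "cantor \<Rightarrow> nat \<Rightarrow> bool" where
  "live Y c \<longleftrightarrow> (\<forall>k. \<exists>t. k < L Y c t)"

lemma eventually_limit: "eventually (\<lambda>t. \<forall>n\<le>k. Xs t n = X n) sequentially"
  using eventually_ball_finite[of "{..k}" "\<lambda>t n. Xs t n = X n" sequentially] limit
  by (simp add: Ball_def)

lemma live_imp_good:
  assumes "live (Phi Z) c"
  shows "good Z c"
  unfolding good_def
proof (intro allI impI)
  fix n assume n: "col n = c"
  obtain t0 where t0: "\<And>t. t0 \<le> t \<Longrightarrow> Xs t n = X n" using limit by (auto simp: eventually_sequentially)
  define k where "k = max n (L (Phi Z) c t0)"
  obtain t where "k < L (Phi Z) c t" using assms by (auto simp: live_def)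
  then obtain s where s: "col s = c" "Phi Z s" "L (Phi Z) c s = k" using lev_attained by blast
  have "t0 \<le> s"
  proof (rule ccontr)
    assume "\<not> t0 \<le> s"
    then have "L (Phi Z) c (Suc s) \<le> L (Phi Z) c t0" by (intro lev_mono) simp
    then show False using s by (simp add: lev_Suc k_def)
  qed
  moreover have "Z n = Xs s n" using s n Phi_unfold[of Z s] by (auto simp: act_def k_def)
  ultimately show "Z n = X n" using t0 by simp
qed

lemma live_lower:
  assumes "live (Phi Z) c" "lt d c"
  shows "live (Phi Z) d"
  unfolding live_def
proof
  fix k
  \<comment> \<open>At level \<open>Suc d\<close> or more, column \<open>d\<close> is among those
    that \<open>c\<close> waits for.\<close>
  obtain t where "max k (Suc d) < L (Phi Z) c t" 
    using assms(1) unfolding live_def by blast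
  then obtain s where s: "col s = c" "Phi Z s" "L (Phi Z) c s = max k (Suc d)" using lev_attained by blast
  then have "max k (Suc d) < L (Phi Z) d s"
    using Phi_unfold[of Z s] assms(2) by (auto simp: act_def)
  then show "\<exists>t. k < L (Phi Z) d t" by (intro exI[of _ s]) simp
qed

lemma not_live_stable:
  assumes "\<not> live Y c"
  obtains k where "\<And>t. L Y c t \<le> k" "eventually (\<lambda>t. L Y c t = k) sequentially"
proof -
  obtain m where m: "\<And>t. L Y c t \<le> m" using assms by (auto simp: live_def not_less)
  obtain t0 where t0: "\<And>t. L Y c t \<le> L Y c t0"
    using ex_has_greatest_nat[of "\<lambda>_. True" 0 "L Y c" "Suc m"] m by (auto simp: less_Suc_eq_le)
  have "eventually (\<lambda>t. L Y c t = L Y c t0) sequentially"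
    using eventually_ge_at_top[of t0]
    by eventually_elim (use t0 lev_mono in \<open>auto intro: antisym\<close>)
  with t0 show thesis by (rule that)
qed

text \<open>Only the finitely many columns with index below \<open>k\<close> count, so one stage
  serves for all of them.\<close>

lemma eventually_unblocked:
  assumes "\<And>d. lt d c \<Longrightarrow> live Y d"
  shows "eventually (\<lambda>t. \<forall>d<k. lt d c \<longrightarrow> k < L Y d t) sequentially"
proof -
  have "eventually (\<lambda>t. lt d c \<longrightarrow> k < L Y d t) sequentially" for d
  proof (cases "lt d c")
    case True
    then obtain t0 where "k < L Y d t0" using assms by (auto simp: live_def)
    then show ?thesis
      by (intro eventually_sequentiallyI[of t0]) (auto intro: less_le_trans lev_mono)
  qed simp
  then show ?thesis
    using eventually_ball_finite[of "{..<k}" "\<lambda>t d. lt d c \<longrightarrow> k < L Y d t" sequentially]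
    by (simp add: Ball_def)
qed

lemma fibre_after:
  assumes "eventually P sequentially"
  obtains t where "col t = col n" "P t"
proof -
  obtain N where N: "\<And>t. N \<le> t \<Longrightarrow> P t" using assms by (auto simp: eventually_sequentially)
  obtain t where "N \<le> t" "col t = col n"
    using fibre[of n] unfolding infinite_nat_iff_unbounded_le by blast
  with N that show thesis by blast
qed

text \<open>Induction along the order of columns. A column stuck at level \<open>k\<close> would be
  served at a late stage, when the smaller columns that count have passed \<open>k\<close> and the
  approximation is correct up to \<open>k\<close>; then it would advance.\<close>

lemma good_imp_live:
  assumes "\<And>d. d \<in> range col \<Longrightarrow> f d \<le> f c \<Longrightarrow> good Z d" "c \<in> range col"
  shows "live (Phi Z) c"
  using assms
proof (induction "f c" arbitrary: c rule: less_induct)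
  case less
  let ?Y = "Phi Z"
  show ?case
  proof (rule ccontr)
    assume "\<not> live ?Y c"
    then obtain k where k: "eventually (\<lambda>t. L ?Y c t = k) sequentially" by (rule not_live_stable)
    have kS: "eventually (\<lambda>t. L ?Y c (Suc t) = k) sequentially"
      using k by (subst eventually_sequentially_Suc)
    have "live ?Y d" if "lt d c" for d
      using less.hyps[of d] less.prems that unfolding lt_iff by fastforce
    then have "eventually (\<lambda>t. \<forall>d<k. lt d c \<longrightarrow> k < L ?Y d t) sequentially"
      by (rule eventually_unblocked)
    from this k eventually_limit[of k] kS
    have ev: "eventually (\<lambda>t. (\<forall>d<k. lt d c \<longrightarrow> k < L ?Y d t) \<and> L ?Y c t = k \<and> (\<forall>n\<le>k. Xs t n = X n)
        \<and> L ?Y c (Suc t) = k) sequentially"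
      by eventually_elim simp
    obtain n where n: "c = col n" using less.prems by blast
    obtain t where "col t = col n"
      and t: "(\<forall>d<k. lt d c \<longrightarrow> k < L ?Y d t) \<and> L ?Y c t = k \<and> (\<forall>n\<le>k. Xs t n = X n) \<and> L ?Y c (Suc t) = k"
      by (rule fibre_after[OF ev]) (rule that)
    then have tc: "col t = c" using n by simp
    have "good Z c" using less.prems by simp
    with t have "act col lt Xs Z ?Y t" unfolding act_def tc good_def by simp
    then have "?Y t" by (simp add: Phi_unfold[symmetric])
    with tc have "L ?Y c (Suc t) = Suc (L ?Y c t)" by (simp add: lev_Suc)
    moreover have "L ?Y c t = k" "L ?Y c (Suc t) = k" using t by blast+
    ultimately show False by linarith
  qed
qed

text \<open>The ordinal of the first column with an error. Having \<alpha> among the candidates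
  keeps the minimum defined and gives \<open>X\<close> the value \<alpha>.\<close>

definition rk :: "cantor \<Rightarrow> ordinal" where
  "rk Z = (LEAST \<gamma>. \<gamma> = \<alpha> \<or> (\<exists>b\<in>range col. \<not> good Z b \<and> f b = \<gamma>))"

lemma rk_le: "rk Z \<le> \<alpha>"
  unfolding rk_def by (rule Least_le) simp

lemma rk_le_bad: "b \<in> range col \<Longrightarrow> \<not> good Z b \<Longrightarrow> rk Z \<le> f b"
  unfolding rk_def by (rule Least_le) blast

lemma rk_cases: "rk Z = \<alpha> \<or> (\<exists>b\<in>range col. \<not> good Z b \<and> f b = rk Z)"
  unfolding rk_def by (rule LeastI[of _ \<alpha>]) simp

lemma rk_less:
  assumes "rk Z < \<alpha>"
  obtains b where "b \<in> range col" "\<not> good Z b" "f b = rk Z"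
  using rk_cases[of Z] assms by auto

lemma good_below_rk: "b \<in> range col \<Longrightarrow> f b < rk Z \<Longrightarrow> good Z b"
  using rk_le_bad[of b Z] by (auto simp: not_less[symmetric])

lemma rk_X: "rk X = \<alpha>"
  using rk_cases[of X] by (auto simp: good_def)

lemma rk_eq_imp: "rk Z = \<alpha> \<Longrightarrow> Z = X"
  using good_below_rk[of "col _" Z] f_less by (force simp: good_def)

text \<open>A live column has no error and all columns below it are live; hence the first column
  with an error stops itself and everything above it.\<close>

lemma live_iff:
  assumes "c \<in> range col"
  shows "live (Phi Z) c \<longleftrightarrow> f c < rk Z"
proof
  assume live: "live (Phi Z) c"
  show "f c < rk Z"
  proof (rule ccontr)
    assume "\<not> f c < rk Z"
    then have le: "rk Z \<le> f c" by simp
    have "f c < \<alpha>" using assms f_less by blast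
    with le have "rk Z < \<alpha>" by simp
    then obtain b where b: "b \<in> range col" "\<not> good Z b" "f b = rk Z" by (rule rk_less)
    have "b = c \<or> lt b c"
      using b le assms inj_onD[OF inj_f, of b c] by (auto simp: lt_iff order_le_less)
    then have "live (Phi Z) b" using live live_lower by blast
    with b(2) live_imp_good show False by blast
  qed
next
  assume "f c < rk Z"
  then show "live (Phi Z) c" using assms by (intro good_imp_live good_below_rk) auto
qed

text \<open>The live columns can be read off the output, and they determine the place of the first
  error.\<close>

lemma Phi_eq_imp_rk_eq:
  assumes "Phi Z = Phi Z'"
  shows "rk Z = rk Z'"
proof -
  have "\<not> rk Z < rk Z'" if eq: "Phi Z = Phi Z'" for Z Z'
  proof
    assume lt: "rk Z < rk Z'"
    then have "rk Z < \<alpha>" using rk_le[of Z'] by simp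
    then obtain b where "b \<in> range col" "f b = rk Z" by (rule rk_less)
    then show False using live_iff[of b Z] live_iff[of b Z'] lt eq by simp
  qed
  from this[OF assms] this[OF assms[symmetric]] show ?thesis by simp
qed

text \<open>A column above \<open>b\<close> whose level exceeds both \<open>b\<close> and
  \<open>k\<close> waits for \<open>b\<close> in vain, as \<open>b\<close> never passes level
  \<open>k\<close>. So on columns not below \<open>b\<close> only the positions up to
  \<open>max b k\<close> matter.\<close>

lemma Phi_eqI:
  assumes b: "b \<in> range col" and k: "\<And>t. L (Phi Z) b t \<le> k"
    and eq: "\<And>n. n \<le> max b k \<or> lt (col n) b \<Longrightarrow> Z' n = Z n"
  shows "Phi Z' = Phi Z"
proof
  fix t
  show "Phi Z' t = Phi Z t"
  proof (induction t rule: less_induct)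
    case (less t)
    define l where "l = L (Phi Z) (col t) t"
    have "act col lt Xs Z (Phi Z) t = act col lt Xs Z' (Phi Z') t"
    proof (cases "l \<le> max b k \<or> lt (col t) b")
      case True
      then show ?thesis by (intro act_cong) (auto simp: less l_def eq)
    next
      case False
      then have l: "b < l" "k < l" by auto
      have "l \<le> k" if "col t = b" using that k by (simp add: l_def)
      with False have "col t \<noteq> b" by auto
      with False b have "lt b (col t)"
        using inj_onD[OF inj_f, of b "col t"] by (auto simp: lt_iff not_less order_le_less)
      moreover have "L (Phi Z) b t \<le> l" using l k[of t] by simp
      moreover have "L (Phi Z') c t = L (Phi Z) c t" for c by (rule lev_cong) (rule less)
      ultimately show ?thesis using l by (auto simp: act_def l_def)
    qed
    then show ?case by (simp add: Phi_unfold[symmetric])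
  qed
qed

lemma Phi_modify_eq:
  assumes b: "b \<in> range col" and k: "\<And>t. L (Phi Z) b t \<le> k" and rk: "f b \<le> rk Z"
  shows "Phi (\<lambda>n. if n \<le> max b k then Z n else X n) = Phi Z"
  using b k
proof (rule Phi_eqI)
  fix n assume n: "n \<le> max b k \<or> lt (col n) b"
  have "good Z (col n)" if "lt (col n) b"
    using that rk by (intro good_below_rk) (auto simp: lt_iff)
  with n show "(if n \<le> max b k then Z n else X n) = Z n" by (auto simp: good_def)
qed

text \<open>The first column with an error is not live, and its bounded level supplies
  \<open>K\<close>; on the columns below it \<open>Z\<close> agrees with \<open>X\<close>
  anyway.\<close>

lemma Phi_finite_modification: "\<exists>K. Phi Z = Phi (\<lambda>n. if n \<le> K then Z n else X n)"
proof (cases "rk Z = \<alpha>")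
  case True
  then have "Z = X" by (rule rk_eq_imp)
  then show ?thesis by simp
next
  case False
  then have "rk Z < \<alpha>" using rk_le[of Z] by simp
  then obtain b where b: "b \<in> range col" "f b = rk Z" by (rule rk_less)
  then have "\<not> live (Phi Z) b" using live_iff by simp
  then obtain k where "\<And>t. L (Phi Z) b t \<le> k" by (rule not_live_stable) (rule that)
  from Phi_modify_eq[OF b(1) this] b(2) show ?thesis by (metis order_refl)
qed

lemma countable_range_Phi: "countable (range Phi)"
proof -
  let ?g = "\<lambda>(K, z :: nat). Phi (\<lambda>n. if n \<le> K then bit z n else X n)"
  have "range Phi \<subseteq> range ?g"
  proof
    fix Y assume "Y \<in> range Phi"
    then obtain Z where "Y = Phi Z" by blast
    then obtain K where "Y = Phi (\<lambda>n. if n \<le> K then Z n else X n)" using Phi_finite_modification by blast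
    also have "(\<lambda>n. if n \<le> K then Z n else X n) = (\<lambda>n. if n \<le> K then bit (num Z (Suc K)) n else X n)"
      by (auto simp: bit_num)
    finally show "Y \<in> range ?g" by (intro range_eqI[of _ _ "(K, num Z (Suc K))"]) simp
  qed
  then show ?thesis by (rule countable_subset) simp
qed

section \<open>Upper and lower bounds for the ranks\<close>

lemma finite_separated:
  assumes "finite F"
  shows "\<exists>m. \<forall>W\<in>F. num W m = num Y m \<longrightarrow> W = Y"
  using assms
proof (induction F)
  case (insert W F)
  then obtain m where m: "\<forall>W\<in>F. num W m = num Y m \<longrightarrow> W = Y" by blast
  obtain k where k: "num W k = num Y k \<longrightarrow> W = Y"
  proof (cases "W = Y")
    case False
    then obtain n where "W n \<noteq> Y n" by blast
    then have "num W (Suc n) \<noteq> num Y (Suc n)" by (auto simp: num_eq_iff)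
    then show ?thesis using that by blast
  qed (use that in blast)
  have "\<forall>W\<in>insert W F. num W (max m k) = num Y (max m k) \<longrightarrow> W = Y"
    using m k by (auto simp: num_eq_iff)
  then show ?case by blast
qed simp

text \<open>Let \<open>b\<close> be the first column with an error, stuck at level \<open>k\<close>.
  At a late stage serving \<open>b\<close> only a wrong bit up to \<open>k\<close> can prevent an
  advance, so an output agreeing up to there forces an error in column \<open>b\<close>. This gives
  \<open>rk Z' \<le> rk Z\<close>; equality leaves finitely many outputs, which a longer prefix
  separates.\<close>

lemma Phi_neighbourhood:
  "\<exists>m. \<forall>Z'. num (Phi Z') m = num (Phi Z) m \<longrightarrow> Phi Z' = Phi Z \<or> rk Z' < rk Z"
proof (cases "rk Z = \<alpha>")
  case True
  then show ?thesis using rk_eq_imp rk_le by (metis order_le_less)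
next
  case False
  then have "rk Z < \<alpha>" using rk_le[of Z] by simp
  then obtain b where b: "b \<in> range col" "f b = rk Z" by (rule rk_less)
  let ?Y = "Phi Z"
  have "\<not> live ?Y b" using b live_iff by simp
  then obtain k where kb: "\<And>t. L ?Y b t \<le> k" and k: "eventually (\<lambda>t. L ?Y b t = k) sequentially"
    by (rule not_live_stable) (rule that)
  have "live ?Y d" if "lt d b" for d using that live_iff[of d Z] b by (auto simp: lt_iff)
  then have unblocked: "eventually (\<lambda>t. \<forall>d<k. lt d b \<longrightarrow> k < L ?Y d t) sequentially"
    by (rule eventually_unblocked)
  obtain t0 where t0: "\<And>t n. t0 \<le> t \<Longrightarrow> n \<le> k \<Longrightarrow> Xs t n = X n"
    using eventually_limit[of k] unfolding eventually_sequentially by blast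
  have "eventually (\<lambda>t. L ?Y b (Suc t) = k) sequentially"
    using k by (subst eventually_sequentially_Suc)
  with unblocked k eventually_ge_at_top[of t0]
  have ev: "eventually (\<lambda>t. (\<forall>d<k. lt d b \<longrightarrow> k < L ?Y d t) \<and> L ?Y b t = k \<and> L ?Y b (Suc t) = k \<and>
      t0 \<le> t) sequentially"
    by eventually_elim simp
  obtain n where n: "b = col n" using b by blast
  obtain t where "col t = col n" and "(\<forall>d<k. lt d b \<longrightarrow> k < L ?Y d t) \<and> L ?Y b t = k \<and> L ?Y b (Suc t) = k \<and> t0 \<le> t"
    by (rule fibre_after[OF ev]) (rule that)
  then have t: "col t = b" "\<forall>d<k. lt d b \<longrightarrow> k < L ?Y d t" "L ?Y b t = k" "L ?Y b (Suc t) = k"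
    and "t0 \<le> t"
    using n by simp_all
  then have Xs: "\<And>s n. t \<le> s \<Longrightarrow> n \<le> k \<Longrightarrow> Xs s n = X n" using t0 by simp
  have "\<not> ?Y t" using t by (auto simp: lev_Suc)
  have near: "\<not> good Z' b \<and> (\<forall>s. L (Phi Z') b s \<le> k)" if eq: "num (Phi Z') (Suc t) = num ?Y (Suc t)" for Z'
  proof -
    let ?Y' = "Phi Z'"
    have Y': "?Y' s = ?Y s" if "s < Suc t" for s using eq that by (auto simp: num_eq_iff)
    then have lev: "L ?Y' c s = L ?Y c s" if "s \<le> Suc t" for c s using that by (intro lev_cong) simp
    have "\<not> act col lt Xs Z' ?Y' t" using Y'[of t] \<open>\<not> ?Y t\<close> by (simp add: Phi_unfold[symmetric])
    then obtain n where n: "n \<le> k" "col n = b" "Z' n \<noteq> X n"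
      using t lev Xs by (auto simp: act_def)
    have "L ?Y' b s \<le> k" for s
    proof (induction s)
      case 0
      show ?case by (simp add: lev_def)
    next
      case (Suc s)
      show ?case
      proof (cases "Suc s \<le> t")
        case True
        then show ?thesis using lev[of "Suc s" b] kb by simp
      next
        case False
        then have ts: "t \<le> s" by simp
        have ge: "k \<le> L ?Y' b s" using lev_mono[OF ts, of col ?Y' b] lev[of t b] t(3) by simp
        have "\<not> (col s = b \<and> ?Y' s)"
        proof
          assume *: "col s = b \<and> ?Y' s"
          then have "act col lt Xs Z' ?Y' s" by (simp add: Phi_unfold[symmetric])
          then have "Z' n = Xs s n" using * n ge by (auto simp: act_def)
          with Xs[OF ts n(1)] n(3) show False by simp
        qed
        with Suc show ?thesis by (auto simp: lev_Suc)
      qed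
    qed
    with n show ?thesis by (auto simp: good_def)
  qed
  \<comment> \<open>If the ranks are equal, \<open>Phi Z'\<close> depends only on the first
    \<open>Suc (max b k)\<close> bits of \<open>Z'\<close>, so it lies in this finite set.\<close>
  define F where "F = (\<lambda>z :: nat. Phi (\<lambda>n. if n \<le> max b k then bit z n else X n)) ` {..<2 ^ Suc (max b k)}"
  obtain m where m: "\<forall>W\<in>F. num W m = num ?Y m \<longrightarrow> W = ?Y"
    using finite_separated[of F ?Y] by (auto simp: F_def)
  have "Phi Z' = Phi Z \<or> rk Z' < rk Z" if eq: "num (Phi Z') (max m (Suc t)) = num ?Y (max m (Suc t))" for Z'
  proof -
    have eq1: "num (Phi Z') (Suc t) = num ?Y (Suc t)" and eq2: "num (Phi Z') m = num ?Y m"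
      using eq by (simp_all add: num_eq_iff)
    have le: "rk Z' \<le> rk Z" using near[OF eq1] rk_le_bad[of b Z'] b by simp
    show ?thesis
    proof (cases "rk Z' = rk Z")
      case True
      then have "Phi (\<lambda>n. if n \<le> max b k then Z' n else X n) = Phi Z'"
        using near[OF eq1] b by (intro Phi_modify_eq) auto
      moreover have "(\<lambda>n. if n \<le> max b k then Z' n else X n) =
          (\<lambda>n. if n \<le> max b k then bit (num Z' (Suc (max b k))) n else X n)"
        by (auto simp: bit_num)
      ultimately have "Phi Z' \<in> F"
        unfolding F_def by (intro image_eqI[of _ _ "num Z' (Suc (max b k))"]) (simp_all add: num_less del: power_Suc)
      then show ?thesis using m eq2 by blast
    qed (use le in \<open>simp add: order_le_less\<close>)
  qed
  then show ?thesis by blast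
qed

text \<open>Near \<open>Phi Z\<close> all other points of the range have smaller \<open>rk\<close>,
  and by induction these are gone by stage \<open>rk Z\<close>.\<close>

lemma not_mem_cb_derivative:
  "Phi Z \<notin> cb_derivative (iterated_derivative (range Phi) (rk Z))"
proof (induction "rk Z" arbitrary: Z rule: less_induct)
  case less
  obtain m where m: "\<And>Z'. num (Phi Z') m = num (Phi Z) m \<Longrightarrow> Phi Z' = Phi Z \<or> rk Z' < rk Z"
    using Phi_neighbourhood[of Z] by blast
  show ?case
  proof
    assume "Phi Z \<in> cb_derivative (iterated_derivative (range Phi) (rk Z))"
    then obtain Y where Y: "Y \<in> iterated_derivative (range Phi) (rk Z)" "Y \<noteq> Phi Z" "num Y m = num (Phi Z) m"
      unfolding mem_cb_derivative_iff by blast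
    note Y' = iffD1[OF mem_iterated_derivative_iff Y(1)]
    then obtain Z' where Z': "Y = Phi Z'" by blast
    have "Phi Z' = Phi Z \<or> rk Z' < rk Z" by (rule m) (use Y(3) Z' in simp)
    with Y(2) Z' have lt: "rk Z' < rk Z" by simp
    from conjunct2[OF Y'] lt have "Y \<in> cb_derivative (iterated_derivative (range Phi) (rk Z'))"
      by simp
    with less[OF lt] Z' show False by simp
  qed
qed

text \<open>The hypothesis \<open>other\<close> allows errors in a finite modification of
  \<open>X\<close>, confined to a given column \<open>c\<close> beyond a given position, without
  leaving \<open>Q\<close>. With \<open>f c = \<delta>\<close> below \<open>rk Z\<close> the result
  has \<open>rk\<close> \<delta>, so by induction it lies in the \<delta>-th derivative; such points
  accumulate at \<open>Phi Z\<close>.\<close>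

lemma mem_iterated_derivative:
  assumes other: "\<And>Z K c. c \<in> range col \<Longrightarrow> (\<And>n. K < n \<Longrightarrow> Z n = X n) \<Longrightarrow> Phi Z \<in> Q \<Longrightarrow>
      \<exists>V. V \<noteq> Z \<and> (\<forall>n. V n \<noteq> Z n \<longrightarrow> col n = c \<and> K < n) \<and> Phi V \<in> Q"
    and Z: "Phi Z \<in> Q"
  shows "Phi Z \<in> iterated_derivative Q (rk Z)"
  using Z
proof (induction "rk Z" arbitrary: Z rule: less_induct)
  case less
  have "\<gamma> \<le> rk Z \<Longrightarrow> Phi Z \<in> iterated_derivative Q \<gamma>" for \<gamma>
  proof (induction \<gamma> rule: less_induct)
    case inner: (less \<gamma>)
    have "Phi Z \<in> cb_derivative (iterated_derivative Q \<delta>)" if \<delta>: "\<delta> < \<gamma>" for \<delta>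
      unfolding mem_cb_derivative_iff
    proof (intro conjI allI)
      have \<delta>rk: "\<delta> < rk Z" using \<delta> inner.prems by simp
      show "Phi Z \<in> iterated_derivative Q \<delta>" using inner.IH[OF \<delta>] \<delta>rk by simp
      fix m
      have "\<delta> < \<alpha>" using \<delta>rk rk_le[of Z] by simp
      then obtain c where c: "c \<in> range col" "f c = \<delta>" using f_onto by blast
      \<comment> \<open>\<open>other\<close> speaks of finite modifications of \<open>X\<close>
        only, so \<open>Z\<close> is replaced by one with the same image, hence with the same
        \<open>rk\<close>.\<close>
      obtain K where "Phi Z = Phi (\<lambda>n. if n \<le> K then Z n else X n)" using Phi_finite_modification by blast
      moreover define Z0 where "Z0 = (\<lambda>n. if n \<le> K then Z n else X n)"
      ultimately have Z0: "Phi Z0 = Phi Z" "\<And>n. K < n \<Longrightarrow> Z0 n = X n" by simp_all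
      have rk0: "rk Z0 = rk Z" by (rule Phi_eq_imp_rk_eq) (rule Z0)
      have "\<exists>V. V \<noteq> Z0 \<and> (\<forall>n. V n \<noteq> Z0 n \<longrightarrow> col n = c \<and> max K m < n) \<and> Phi V \<in> Q"
        by (rule other) (use c Z0 less.prems in simp_all)
      then obtain V where V: "V \<noteq> Z0" "\<And>n. V n \<noteq> Z0 n \<Longrightarrow> col n = c \<and> max K m < n" "Phi V \<in> Q"
        by blast
      have "\<not> good V c"
      proof -
        obtain n where "V n \<noteq> Z0 n" using V(1) by (auto simp: fun_eq_iff)
        moreover have "good Z0 c" using c \<delta>rk rk0 by (intro good_below_rk) auto
        ultimately show ?thesis using V(2)[of n] by (auto simp: good_def)
      qed
      then have "rk V \<le> \<delta>" using rk_le_bad c by blast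
      \<comment> \<open>\<open>V\<close> differs from \<open>Z0\<close> in column \<open>c\<close>
        only, and \<open>Z0\<close> is correct on all smaller columns.\<close>
      moreover have "\<not> rk V < \<delta>"
      proof
        assume lt: "rk V < \<delta>"
        then have "rk V < \<alpha>" using \<open>\<delta> < \<alpha>\<close> by simp
        then obtain d where d: "d \<in> range col" "\<not> good V d" "f d = rk V" by (rule rk_less)
        have "good Z0 d" using d lt \<delta>rk rk0 by (intro good_below_rk) auto
        have "V n = X n" if n: "col n = d" for n
        proof -
          have "col n \<noteq> c" using n d(3) c(2) lt by auto
          then have "V n = Z0 n" using V(2)[of n] by blast
          with \<open>good Z0 d\<close> n show ?thesis by (simp add: good_def)
        qed
        with d(2) show False by (simp add: good_def)
      qed
      ultimately have rkV: "rk V = \<delta>" by simp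
      have "Phi V \<in> iterated_derivative Q \<delta>" using less.hyps[of V] rkV \<delta>rk V(3) by simp
      moreover have "Phi V \<noteq> Phi Z" using Phi_eq_imp_rk_eq[of V Z] rkV \<delta>rk by auto
      moreover have "num V m = num Z0 m"
        unfolding num_eq_iff using V(2) by (metis max.strict_boundedE not_less_iff_gr_or_eq)
      then have "num (Phi V) m = num (Phi Z) m" using Phi_prefix[of V m Z0] Z0(1) by simp
      ultimately show "\<exists>Y\<in>iterated_derivative Q \<delta>. Y \<noteq> Phi Z \<and> num Y m = num (Phi Z) m" by blast
    qed
    with less.prems show ?case by (intro iffD2[OF mem_iterated_derivative_iff] conjI allI impI)
  qed
  then show ?case by simp
qed

end

section \<open>The measure\<close>

lemma rec_in_lev:
  assumes col: "rec_in A col" and Y: "dec2_in A Y" and c: "rec_in A c" and t: "rec_in A t"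
  shows "rec_in A (\<lambda>x. lev col (Y x) (c x) (t x))"
  unfolding lev_def
  by (intro rec_intros rec_in_comp[OF col] dec_in_comp2[OF Y] rec_in_comp[OF c] t)

lemma dec_in_act:
  assumes col: "rec_in A col" and lt: "dec2_in A lt" and Xs: "dec2_in A Xs"
    and Z: "dec2_in A Z" and Y: "dec2_in A Y" and t: "rec_in A t"
  shows "dec_in A (\<lambda>x. act col lt Xs (Z x) (Y x) (t x))"
proof -
  have Y': "dec2_in A (\<lambda>z. Y (pfst z))" by (rule dec2_inI) (intro dec_in_comp2[OF Y] rec_intros)
  show ?thesis
    unfolding act_def
    by (intro rec_intros rec_in_lev[OF col] Y Y' rec_in_comp[OF col] rec_in_comp[OF t]
        dec_in_comp2[OF lt] dec_in_comp2[OF Xs] dec_in_comp2[OF Z] t)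
qed

lemma rec_in_hist_act:
  assumes col: "rec_in A col" and lt: "dec2_in A lt" and Xs: "dec2_in A Xs"
    and Z: "dec2_in A Z" and s: "rec_in A s"
  shows "rec_in A (\<lambda>x. hist (act col lt Xs (Z x)) (s x))"
proof -
  have Z': "dec2_in A (\<lambda>z. Z (pfst z))" by (rule dec2_inI) (intro dec_in_comp2[OF Z] rec_intros)
  show ?thesis
    by (intro rec_in_hist dec_in_act col lt Xs Z' s rec_intros)
qed

locale random_columns = columns +
  assumes col: "rec_in no_oracle col" and lt: "dec2_in no_oracle lt" and Xs: "dec2_in no_oracle Xs"
    and random: "ml_random cantor_lebesgue X"
begin

text \<open>The action of \<open>Phi\<close> on prefixes. Measuring cylinders under
  \<open>mu\<close> thus becomes counting numbers below \<open>2 ^ s\<close>.\<close>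

definition h :: "nat \<Rightarrow> nat \<Rightarrow> nat" where
  "h s z = hist (act col lt Xs (bit z)) s"

lemma hist_act: "hist (act col lt Xs Z) s = num (Phi Z) s"
  by (simp add: hist_eq_num Phi_def)

lemma num_Phi: "num (Phi Z) s = h s (num Z s)"
  unfolding h_def hist_act by (rule Phi_prefix) (simp add: num_eq_iff bit_num)

lemma rec_in_h:
  assumes u: "rec_in no_oracle u" and v: "rec_in no_oracle v"
  shows "rec_in no_oracle (\<lambda>x. h (u x) (v x))"
  unfolding h_def
  by (intro rec_in_hist_act col lt Xs dec2_inI dec_in_bit rec_in_comp[OF v] u rec_intros)

lemma continuous_Phi: "continuous_on UNIV Phi"
proof (rule continuous_on_coordinatewise_then_product)
  fix t
  have "open {Z. Phi Z t \<in> B}" for B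
  proof (rule open_local[where s = "Suc t"])
    fix Z Z' assume "Phi Z t \<in> B" and eq: "num Z (Suc t) = num Z' (Suc t)"
    then show "Phi Z' t \<in> B" using Phi_prefix[OF eq] by (simp add: num_eq_iff)
  qed
  then show "continuous_on UNIV (\<lambda>Z. Phi Z t)"
    by (simp add: continuous_on_open_vimage vimage_def)
qed

definition mu :: "cantor measure" where
  "mu = distr cantor_lebesgue borel Phi"

lemma measurable_Phi: "Phi \<in> measurable cantor_lebesgue borel"
proof -
  have "measurable cantor_lebesgue borel = measurable borel (borel :: cantor measure)"
    by (rule measurable_cong_sets) (simp_all add: sets_cantor_lebesgue)
  with borel_measurable_continuous_onI[OF continuous_Phi] show ?thesis by simp
qed

lemma prob_space_mu: "prob_space mu"
  unfolding mu_def by (rule prob_space.prob_space_distr[OF prob_space_cantor_lebesgue measurable_Phi])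

lemma sets_mu: "sets mu = sets borel"
  by (simp add: mu_def)

lemma measure_mu: "A \<in> sets borel \<Longrightarrow> measure mu A = measure cantor_lebesgue {Z. Phi Z \<in> A}"
  unfolding mu_def by (simp add: measure_distr[OF measurable_Phi] vimage_def)

lemma measure_mu_num: "measure mu {Y. num Y s = y} = real (card {z. z < 2 ^ s \<and> h s z = y}) / 2 ^ s"
proof -
  have "{Y. num Y s = y} \<in> sets borel" by (intro borel_open open_num)
  then show ?thesis using measure_num[of "\<lambda>z. h s z = y" s] by (simp add: measure_mu num_Phi)
qed

lemma cylinder_eq: "cylinder \<sigma> = {Y. num Y (length \<sigma>) = snum \<sigma>}"
  using mem_cylinder_iff by blast

lemma computable_mu: "computable_measure mu"
  unfolding computable_measure_def
proof (rule computable_real_fun_dyadic)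
  show "rec2_in no_oracle (\<lambda>s y. \<Sum>z<2 ^ s. of_bool (h s z = y))"
    by (intro rec_intros rec_in_h)
  show "measure mu (cylinder \<sigma>) =
      real (\<Sum>z<2 ^ length \<sigma>. of_bool (h (length \<sigma>) z = snum \<sigma>)) / 2 ^ length \<sigma>" for \<sigma>
    by (simp add: cylinder_eq measure_mu_num sum_of_bool_eq Int_def)
qed

lemma mem_support_iff: "Y \<in> measure_support mu \<longleftrightarrow> (\<forall>s. \<exists>z<2 ^ s. h s z = num Y s)"
proof -
  have "cylinder (restrict_to Y s) = {Y'. num Y' s = num Y s}" for s
    by (auto simp: cylinder_def restrict_to_def num_eq_iff)
  moreover have "0 < card {z. z < 2 ^ s \<and> h s z = num Y s} \<longleftrightarrow> (\<exists>z<2 ^ s. h s z = num Y s)" for s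
    by (auto simp: card_gt_0_iff)
  ultimately show ?thesis by (simp add: measure_support_def measure_mu_num zero_less_divide_iff)
qed

text \<open>By compactness, a sequence each of whose prefixes is a prefix of some value of
  \<open>Phi\<close> is itself a value of \<open>Phi\<close>.\<close>

lemma support_eq: "measure_support mu = range Phi"
proof (intro equalityI subsetI)
  fix Y assume Y: "Y \<in> measure_support mu"
  have "\<exists>Z. \<forall>s. num (Phi Z) s = num Y s"
  proof (rule compactness)
    fix s
    obtain z where "z < 2 ^ s" "h s z = num Y s" using iffD1[OF mem_support_iff Y] by blast
    then have "num (Phi (bit z)) s = num Y s" by (simp add: num_Phi num_bit_less)
    then show "\<exists>Z. num (Phi Z) s = num Y s" by (rule exI[of _ "bit z"])
  next
    show "num (Phi Z) (Suc s) = num Y (Suc s) \<Longrightarrow> num (Phi Z) s = num Y s" for s Z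
      by (simp add: num_eq_iff)
    show "num (Phi Z) s = num Y s \<Longrightarrow> num Z s = num Z' s \<Longrightarrow> num (Phi Z') s = num Y s" for s Z Z'
      using Phi_prefix[of Z s Z'] by simp
  qed
  then obtain Z where "\<forall>s. num (Phi Z) s = num Y s" ..
  then have "num (Phi Z) s = num Y s" for s by simp
  then have "Phi Z n = Y n" for n by (rule iffD1[OF num_eq_iff, rule_format, of _ "Suc n"]) simp
  then have "Y = Phi Z" by (simp add: fun_eq_iff)
  then show "Y \<in> range Phi" by simp
next
  fix Y assume "Y \<in> range Phi"
  then obtain Z where "Y = Phi Z" by blast
  then have "num Z s < 2 ^ s \<and> h s (num Z s) = num Y s" for s
    by (simp add: num_less num_Phi)
  then show "Y \<in> measure_support mu"
    unfolding mem_support_iff by blast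
qed

lemma range_Phi_eq: "range Phi = {Y. \<forall>s. \<exists>z<2 ^ s. h s z = num Y s}"
  unfolding support_eq[symmetric] by (simp add: set_eq_iff mem_support_iff)

lemma pi01_range_Phi: "pi01_class (range Phi)"
  unfolding range_Phi_eq by (intro pi01_classI rec_intros rec_in_h)

lemma range_Phi_borel: "range Phi \<in> sets borel"
proof -
  have "open {Y. \<exists>s. \<not> (\<exists>z<2 ^ s. h s z = num Y s)}" by (rule open_decidable_union)
  then have "closed (range Phi)" unfolding range_Phi_eq closed_def by (simp add: Collect_neg_eq[symmetric])
  then show ?thesis by simp
qed

lemma countably_supported_mu: "countably_supported mu"
proof -
  interpret prob_space cantor_lebesgue by (rule prob_space_cantor_lebesgue)
  have "range (from_nat_into (range Phi)) = range Phi"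
    by (rule range_from_nat_into) (simp_all add: countable_range_Phi)
  moreover have "emeasure mu (range Phi) = 1"
  proof -
    have "Phi -` range Phi \<inter> space cantor_lebesgue = space cantor_lebesgue" by auto
    then show ?thesis
      unfolding mu_def emeasure_distr[OF measurable_Phi range_Phi_borel] by (simp only: emeasure_space_1)
  qed
  ultimately show ?thesis
    unfolding countably_supported_def by (intro exI[of _ "from_nat_into (range Phi)"]) simp
qed

text \<open>Conservation of randomness: the preimages of a test for \<open>mu\<close> form a test
  for Lebesgue measure, uniformly effectively open because \<open>Phi\<close> acts computably on
  prefixes.\<close>

lemma ml_random_Phi: "ml_random mu (Phi X)"
  unfolding ml_random_def
proof (intro allI impI)
  fix U assume test: "ml_test mu U"
  then have "uniformly_sigma01 U" by (simp add: ml_test_def)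
  then obtain T where T: "dec3_in no_oracle T" and U: "\<And>i. U i = {Z. \<exists>s. T i s (num Z s)}"
    by (rule uniformly_sigma01_decidable) (rule that)
  have pre: "{Z. Phi Z \<in> U i} = {Z. \<exists>s. T i s (h s (num Z s))}" for i
    by (simp add: U num_Phi)
  have "ml_test cantor_lebesgue (\<lambda>i. {Z. Phi Z \<in> U i})"
    unfolding ml_test_def
  proof (intro conjI allI)
    have "dec3_in no_oracle (\<lambda>i s z. T i s (h s z))"
      by (intro dec3_inI dec_in_comp3[OF T] rec_in_h rec_intros)
    from uniformly_sigma01I[OF this] show "uniformly_sigma01 (\<lambda>i. {Z. Phi Z \<in> U i})"
      unfolding pre .
    fix i
    have "U i \<in> sets borel" unfolding U by (intro borel_open open_decidable_union)
    moreover have "measure mu (U i) \<le> 1 / 2 ^ i" using test by (simp add: ml_test_def)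
    ultimately show "measure cantor_lebesgue {Z. Phi Z \<in> U i} \<le> 1 / 2 ^ i"
      by (simp add: measure_mu)
  qed
  from random[unfolded ml_random_def, rule_format, OF this]
  have "X \<notin> (\<Inter>i. {Z. Phi Z \<in> U i})" .
  then show "Phi X \<notin> (\<Inter>i. U i)" by blast
qed

lemma Phi_X_le: "Phi X \<le>\<^sub>T X"
proof -
  have eq: "Phi X = (\<lambda>t. bit (hist (act col lt Xs X) (Suc t)) t)"
    by (rule ext) (simp add: hist_act bit_num del: hist.simps)
  show ?thesis
    unfolding turing_reducible_iff
    by (subst eq)
      (intro rec_intros rec_in_hist_act rec_in_no_oracle[OF col] dec2_in_no_oracle[OF lt]
        dec2_in_no_oracle[OF Xs] dec_in_oracle)
qed

text \<open>All columns are live on input \<open>X\<close>, so the column of \<open>n\<close>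
  advances at level \<open>n\<close> at some stage. \<open>Phi X\<close> can search for this stage,
  at which \<open>X n\<close> was found equal to its approximation.\<close>

lemma X_le_Phi: "X \<le>\<^sub>T Phi X"
proof -
  define P where "P n t \<longleftrightarrow> col t = col n \<and> Phi X t \<and> lev col (Phi X) (col n) t = n" for n t
  have ex: "\<exists>t. P n t" for n
  proof -
    have "live (Phi X) (col n)" using live_iff[of "col n" X] f_less by (simp add: rk_X)
    then obtain t where "n < lev col (Phi X) (col n) t" unfolding live_def by blast
    then show ?thesis unfolding P_def using lev_attained by blast
  qed
  have "X n = Xs (LEAST t. P n t) n" for n
  proof -
    define t where "t = (LEAST t. P n t)"
    have "P n t" unfolding t_def by (rule LeastI_ex) (rule ex)
    then have "act col lt Xs X (Phi X) t" "col t = col n" "lev col (Phi X) (col t) t = n"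
      by (simp_all add: P_def Phi_unfold[symmetric])
    then show ?thesis unfolding act_def t_def[symmetric] by simp
  qed
  then have eq: "X = (\<lambda>n. Xs (LEAST t. P n t) n)" by blast
  have "dec2_in (Phi X) P"
    unfolding P_def
    by (intro rec_intros rec_in_lev dec_in_oracle rec_in_no_oracle[OF col]
        rec_in_comp[OF rec_in_no_oracle[OF col]])
  from rec_in_LEAST[OF this ex] show ?thesis
    unfolding turing_reducible_iff
    by (subst eq) (intro dec_in_comp2[OF dec2_in_no_oracle[OF Xs]] rec_in_id)
qed

text \<open>\<open>ml_random_other_member\<close> is applied to the class of all \<open>W\<close>
  whose tail beyond \<open>K\<close>, put behind the initial bits of \<open>Z\<close>, is mapped
  into \<open>Q\<close>; \<open>C\<close> consists of the positions of column \<open>c\<close>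
  beyond \<open>K\<close>.\<close>

lemma other_member:
  assumes Q: "pi01_class Q" and c: "c \<in> range col" and ZX: "\<And>n. K < n \<Longrightarrow> Z n = X n"
    and Z: "Phi Z \<in> Q"
  shows "\<exists>V. V \<noteq> Z \<and> (\<forall>n. V n \<noteq> Z n \<longrightarrow> col n = c \<and> K < n) \<and> Phi V \<in> Q"
proof -
  obtain T where T: "dec2_in no_oracle T" and QT: "Q = {Y. \<forall>s. T s (num Y s)}"
    by (rule pi01_class_decidable[OF Q]) (rule that)
  \<comment> \<open>The initial bits of \<open>Z\<close> enter as a constant, which keeps
    \<open>S\<close> decidable although \<open>Z\<close> need not be computable.\<close>
  define z where "z = num Z (Suc K)"
  define S where "S s w \<longleftrightarrow> T s (hist (act col lt Xs (\<lambda>n. if n \<le> K then bit z n else bit w n)) s)" for s w :: nat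
  have S: "S s (num W s) \<longleftrightarrow> T s (num (Phi (\<lambda>n. if n \<le> K then Z n else W n)) s)" for s W
  proof -
    have "num (Phi (\<lambda>n. if n \<le> K then bit z n else bit (num W s) n)) s =
        num (Phi (\<lambda>n. if n \<le> K then Z n else W n)) s"
      by (rule Phi_prefix) (auto simp: num_eq_iff bit_num z_def)
    then show ?thesis by (simp add: S_def hist_act)
  qed
  have "(\<lambda>n. if n \<le> K then Z n else X n) = Z" using ZX by (auto simp: not_le)
  then have SX: "S s (num X s)" for s using Z by (simp add: S QT)
  have "infinite {n. col n = c \<and> K < n}"
  proof -
    have "infinite ({n. col n = c} - {..K})" using fibre c by (intro Diff_infinite_finite) auto
    then show ?thesis by (rule infinite_super[rotated]) auto
  qed
  moreover have "dec_in no_oracle (\<lambda>n. col n = c \<and> K < n)"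
    by (intro rec_intros col)
  moreover have "dec2_in no_oracle S"
    unfolding S_def
    by (intro dec2_inI dec_in_comp2[OF T] rec_in_hist_act col lt Xs rec_intros)
  ultimately have "\<exists>V. V \<noteq> X \<and> (\<forall>n. \<not> (col n = c \<and> K < n) \<longrightarrow> V n = X n) \<and> (\<forall>s. S s (num V s))"
    using ml_random_other_member[of X S "\<lambda>n. col n = c \<and> K < n"] random SX by blast
  then obtain V where V: "V \<noteq> X" "\<And>n. \<not> (col n = c \<and> K < n) \<Longrightarrow> V n = X n" "\<And>s. S s (num V s)"
    by blast
  define V' where "V' = (\<lambda>n. if n \<le> K then Z n else V n)"
  obtain n where n: "V n \<noteq> X n" using V(1) by (auto simp: fun_eq_iff)
  then have "K < n" using V(2) by blast
  then have "V' n \<noteq> Z n" using n ZX by (simp add: V'_def)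
  then have "V' \<noteq> Z" by auto
  moreover have "col n = c \<and> K < n" if "V' n \<noteq> Z n" for n
    using that V(2)[of n] ZX[of n] by (auto simp: V'_def split: if_splits)
  moreover have "Phi V' \<in> Q" using V(3) by (simp add: QT S V'_def)
  ultimately show ?thesis by blast
qed

section \<open>Ranks of the points of the support\<close>

lemma Phi_mem_iterated_derivative:
  assumes "pi01_class Q" "Phi Z \<in> Q"
  shows "Phi Z \<in> iterated_derivative Q (rk Z)"
  by (rule mem_iterated_derivative) (use assms other_member in auto)

lemma exits_at_rk: "exits_at (range Phi) (Phi Z) (rk Z)"
  unfolding exits_at_def
  using Phi_mem_iterated_derivative[OF pi01_range_Phi] not_mem_cb_derivative by blast

lemma cb_rank_Phi: "cb_rank (Phi Z) = rk Z"
  by (rule cb_rank_eq[OF pi01_range_Phi _ exits_at_rk]) (auto intro: Phi_mem_iterated_derivative)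

lemma ranked_Phi: "ranked (Phi Z)"
  unfolding ranked_def rank_in_defined_def using pi01_range_Phi exits_at_rk by blast

lemma rank_faithful_support: "rank_faithful (measure_support mu)"
  unfolding support_eq rank_faithful_def rank_in_defined_def
proof (intro conjI ballI impI)
  show "pi01_class (range Phi)" by (rule pi01_range_Phi)
  fix Y assume "Y \<in> range Phi"
  then obtain Z where Z: "Y = Phi Z" by blast
  show "\<exists>\<beta>. exits_at (range Phi) Y \<beta>" unfolding Z using exits_at_rk by blast
  show "cb_rank Y = rank_in (range Phi) Y"
    unfolding Z cb_rank_Phi rank_in_eq[OF exits_at_rk] ..
qed

end

theorem theorem1p1:
  fixes r :: "cantor set" and \<alpha> :: ordinal
  assumes "delta02_random_degree r"
    and "computable_ordinal \<alpha>" and "\<alpha> > 0"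
  shows "\<exists>(\<mu> :: cantor measure) (R :: cantor).
           prob_space \<mu> \<and> sets \<mu> = sets borel \<and>
           computable_measure \<mu> \<and> countably_supported \<mu> \<and>
           R \<in> r \<and>
           ml_random \<mu> R \<and>
           (ranked R \<and> cb_rank R = \<alpha>) \<and>
           rank_faithful (measure_support \<mu>)"
proof -
  obtain X0 X where X0: "X0 \<le>\<^sub>T halting" "r = turing_degree X0" and X: "X \<in> r" "ml_random cantor_lebesgue X"
    using assms(1) unfolding delta02_random_degree_def delta02_degree_def by blast
  then have X0X: "X0 \<le>\<^sub>T X" "X \<le>\<^sub>T X0" by (auto simp: turing_degree_def)
  obtain Xs where Xs: "dec2_in no_oracle Xs" "\<And>n. eventually (\<lambda>t. Xs t n = X n) sequentially"
    by (rule limit_lemma[OF turing_reducible_trans[OF X0X(2) X0(1)]]) (rule that)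
  obtain W :: "nat rel" where W: "Well_order W" "computable_set (prod_encode ` W)" "has_order_type W \<alpha>"
    using assms(2) unfolding computable_ordinal_def by blast
  obtain f where f: "\<And>b. b \<in> Field W \<Longrightarrow> f b < \<alpha>" "\<And>\<gamma>. \<gamma> < \<alpha> \<Longrightarrow> \<exists>b\<in>Field W. f b = \<gamma>"
    "\<And>b c. (b, c) \<in> W \<Longrightarrow> b \<noteq> c \<Longrightarrow> f b < f c"
    by (rule order_type_segments[OF W(1,3)]) (rule that)
  \<comment> \<open>Positivity of \<alpha> provides at least one column.\<close>
  obtain c0 where c0: "c0 \<in> Field W" using f(2)[OF assms(3)] by blast
  have refl: "(c, c) \<in> W \<longleftrightarrow> c \<in> Field W" for c
    using W(1) by (auto simp: order_on_defs refl_on_def intro: FieldI1)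
  have total: "(b, c) \<in> W \<or> (c, b) \<in> W" if "b \<in> Field W" "c \<in> Field W" for b c
    using W(1) that refl by (cases "b = c") (auto simp: order_on_defs total_on_def)
  have decW: "dec2_in no_oracle (\<lambda>b c. (b, c) \<in> W)"
  proof -
    have "dec_in no_oracle (\<lambda>n. n \<in> prod_encode ` W)" using W(2) by (simp add: computable_set_iff)
    moreover have "z \<in> prod_encode ` W \<longleftrightarrow> (pfst z, psnd z) \<in> W" for z
      by (metis image_iff prod.collapse prod_decode_inverse prod_encode_inverse)
    ultimately show ?thesis by (simp add: dec2_in_def)
  qed
  \<comment> \<open>Membership in the field is decided by reflexivity. Positions whose first
    component lies outside the field are added to \<open>c0\<close>, which makes \<open>col\<close>
    total.\<close>
  define col where "col n = (if (pfst n, pfst n) \<in> W then pfst n else c0)" for n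
  define lt where "lt b c \<longleftrightarrow> (b, c) \<in> W \<and> b \<noteq> c" for b c
  have col_pair: "col (pair c k) = c" if "c \<in> Field W" for c k using that by (simp add: col_def refl)
  have colW: "col n \<in> Field W" for n using c0 by (simp add: col_def refl)
  have range: "range col = Field W"
  proof
    show "Field W \<subseteq> range col" using col_pair by (metis rangeI subsetI)
  qed (use colW in blast)
  interpret random_columns col lt X Xs f \<alpha>
  proof
    show "infinite {t. col t = col n}" for n
    proof -
      have "inj (\<lambda>k. pair (col n) k)" by (rule injI) simp
      then have "infinite (range (\<lambda>k. pair (col n) k))" by (rule range_inj_infinite)
      then show ?thesis by (rule infinite_super[rotated]) (auto simp: col_pair colW)
    qed
    show lt_iff: "lt d c \<longleftrightarrow> d \<in> range col \<and> c \<in> range col \<and> f d < f c" for d c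
      unfolding range lt_def using f(3)[of d c] f(3)[of c d] total[of d c]
      by (auto intro: FieldI1 FieldI2 dest: less_asym)
    show "inj_on f (range col)"
      unfolding range using f(3) total by (intro inj_onI) (metis less_irrefl)
    show "f (col n) < \<alpha>" for n using f(1) colW by blast
    show "\<exists>n. f (col n) = \<gamma>" if "\<gamma> < \<alpha>" for \<gamma>
      using f(2)[OF that] col_pair by metis
    show "eventually (\<lambda>t. Xs t n = X n) sequentially" for n by (rule Xs)
    show "rec_in no_oracle col"
      unfolding col_def by (intro rec_intros dec_in_comp2[OF decW])
    show "dec2_in no_oracle lt"
      unfolding lt_def by (intro rec_intros dec_in_comp2[OF decW])
  qed (fact Xs X)+
  have "Phi X \<in> r"
    unfolding X0(2) turing_degree_def
    using turing_reducible_trans[OF X0X(1) X_le_Phi] turing_reducible_trans[OF Phi_X_le X0X(2)] by simp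
  moreover have "cb_rank (Phi X) = \<alpha>" by (simp add: cb_rank_Phi rk_X)
  ultimately show ?thesis
    using prob_space_mu sets_mu computable_mu countably_supported_mu ml_random_Phi ranked_Phi
      rank_faithful_support by blast
qed

end
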